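(* Let $M=\langle A\mid w_1=1,\ldots,w_k=1\rangle$ be a finitely presented special monoid with group of units $G$, and let $N=\{(u,v)\in M\times M: uv=1\}$ with multiplication $(a,b)\cdot(x,y)=(ax,yb)$. Then $N$ is isomorphic to a free product $G\ast C^*$ where $C$ is a finite set. More precisely, let $X\cup Y$ be the finite generating set of $N$ with $$Y=\{(\delta,\delta^{-1}):\delta\in\Delta\}$$ and $X$ the set of all pairs $(\delta_1,\delta_2\delta^{-1})$ such that: (1) $\delta_1,\delta_2\in A^+$ are reduced; (2) $\delta\equiv\delta_1\delta_2$ is invertible; (3) $(\delta_1,\delta_2)$ has height $0$; (4) $\delta_1$ has no invertible suffix. Then $X$ is a basis for a free submonoid of $N$ and $N\cong G\ast X^*$, where the copy of $G$ is identified with $\langle Y\rangle$.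
   Context: $A$ is a finite alphabet and $w_1,\dots,w_k\in A^*$. $M$ is the quotient of $A^*$ by the congruence generated by the pairs $(w_i,1)$. For words $u,v$: $u\equiv v$ means equal as words, $u=v$ means equal in $M$. Pairs of words in $N$ denote the pairs of elements of $M$ they represent. A word is invertible if it represents an element of the group of units $G$ of $M$. A nonempty invertible word is indecomposable if it has no nonempty proper prefix that is invertible; every nonempty invertible word factors uniquely as a product of nonempty indecomposable invertible words. Write $w_i\equiv w_{i,1}\cdots w_{i,n_i}$ for this factorisation of $w_i$. $\Delta$ is the (finite) set of all indecomposable invertible words $\delta\in A^+$ with $|\delta|\le\max_{1\le i\le k}|w_i|$ such that $\delta=w_{i,j}$ in $M$ for some $1\le i\le k$, $1\le j\le n_i$. Let $<_s$ be the short-lex order on $A^*$ induced by a fixed total order on $A$, and let $S=\{u\to v: u,v\in\Delta^*,\ u=v\text{ in }M,\ u>_s v\}$; this is a complete rewriting system defining $M$. A word is reduced if it is irreducible with respect to $S$; each element of $M$ is represented by a unique reduced word. For an invertible word $\alpha$, $\alpha^{-1}$ denotes the reduced word representing the inverse of $\alpha$ in $M$. For nonempty words $u,v$, an invertible word $z$ cuts across $(u,v)$ if $u\equiv u_1u_2$, $v\equiv v_1v_2$ with $z\equiv u_2v_1$ and $u_2,v_1$ nonempty. The invertible words cutting across $(u,v)$ are regarded as occurrences of subwords of $uv$ (distinct occurrences being distinct elements), partially ordered by inclusion. If at least one exists, the height of $(u,v)$ is the length of a longest chain in this poset, where a one-element chain has length $0$; so $(\delta_1,\delta_2)$ with $\delta_1\delta_2$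 invertible has height $0$ iff $\delta_1\delta_2$ is the only invertible word cutting across $(\delta_1,\delta_2)$. A nonempty reduced word has no invertible suffix if it has no nonempty suffix that is an invertible word. $X^*$ and $C^*$ denote free monoids; $\ast$ denotes the free product of monoids; $\langle Y\rangle$ is the submonoid of $N$ generated by $Y$. *)

theory Defs
  imports "HOL-Algebra.Group" "HOL-Library.Sublist" "HOL.Hull"
begin

section \<open>Monoid presentations, free monoids and free products\<close>

inductive_set word_cong :: "'a set \<Rightarrow> ('a list \<times> 'a list) set \<Rightarrow> ('a list \<times> 'a list) set"
  for A :: "'a set" and R :: "('a list \<times> 'a list) set" where
  base: "(u, v) \<in> R \<Longrightarrow> u \<in> lists A \<Longrightarrow> v \<in> lists A \<Longrightarrow> (u, v) \<in> word_cong A R"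
| refl: "u \<in> lists A \<Longrightarrow> (u, u) \<in> word_cong A R"
| sym: "(u, v) \<in> word_cong A R \<Longrightarrow> (v, u) \<in> word_cong A R"
| trans: "(u, v) \<in> word_cong A R \<Longrightarrow> (v, w) \<in> word_cong A R \<Longrightarrow> (u, w) \<in> word_cong A R"
| mult: "(u, u') \<in> word_cong A R \<Longrightarrow> (v, v') \<in> word_cong A R \<Longrightarrow>
    (u @ v, u' @ v') \<in> word_cong A R"

definition word_class :: "'a set \<Rightarrow> ('a list \<times> 'a list) set \<Rightarrow> 'a list \<Rightarrow> 'a list set" where
  "word_class A R u = word_cong A R `` {u}"

definition presented_monoid :: "'a set \<Rightarrow> ('a list \<times> 'a list) set \<Rightarrow> 'a list set monoid" where
  "presented_monoid A R =
    \<lparr>carrier = lists A // word_cong A R,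
     mult = (\<lambda>P Q. \<Union>p\<in>P. \<Union>q\<in>Q. word_class A R (p @ q)),
     one = word_class A R []\<rparr>"

definition free_monoid :: "'a set \<Rightarrow> 'a list monoid" where
  "free_monoid A = \<lparr>carrier = lists A, mult = (@), one = []\<rparr>"

text \<open>The free product is the monoid presented by the disjoint union of the carriers of the
  factors, subject to the multiplication table and the unit of each factor.\<close>

definition free_product_rels ::
  "('a, 'm) monoid_scheme \<Rightarrow> ('b, 'n) monoid_scheme \<Rightarrow> (('a + 'b) list \<times> ('a + 'b) list) set" where
  "free_product_rels G H =
     {([Inl a, Inl b], [Inl (a \<otimes>\<^bsub>G\<^esub> b)]) | a b. a \<in> carrier G \<and> b \<in> carrier G} \<union>
     {([Inr a, Inr b], [Inr (a \<otimes>\<^bsub>H\<^esub> b)]) | a b. a \<in> carrier H \<and> b \<in> carrier H} \<union>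
     {([Inl \<one>\<^bsub>G\<^esub>], []), ([Inr \<one>\<^bsub>H\<^esub>], [])}"

definition free_product ::
  "('a, 'm) monoid_scheme \<Rightarrow> ('b, 'n) monoid_scheme \<Rightarrow> ('a + 'b) list set monoid" where
  "free_product G H = presented_monoid (carrier G <+> carrier H) (free_product_rels G H)"

definition free_product_inl ::
  "('a, 'm) monoid_scheme \<Rightarrow> ('b, 'n) monoid_scheme \<Rightarrow> 'a \<Rightarrow> ('a + 'b) list set" where
  "free_product_inl G H a = word_class (carrier G <+> carrier H) (free_product_rels G H) [Inl a]"

definition free_product_inr ::
  "('a, 'm) monoid_scheme \<Rightarrow> ('b, 'n) monoid_scheme \<Rightarrow> 'b \<Rightarrow> ('a + 'b) list set" where
  "free_product_inr G H b = word_class (carrier G <+> carrier H) (free_product_rels G H) [Inr b]"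

definition submonoid_generated :: "('a, 'm) monoid_scheme \<Rightarrow> 'a set \<Rightarrow> 'a set" where
  "submonoid_generated N Y = (\<lambda>H. submonoid H N) hull Y"

definition word_value :: "('a, 'm) monoid_scheme \<Rightarrow> 'a list \<Rightarrow> 'a" where
  "word_value N xs = foldr (mult N) xs \<one>\<^bsub>N\<^esub>"

definition basis_of_free_submonoid :: "('a, 'm) monoid_scheme \<Rightarrow> 'a set \<Rightarrow> bool" where
  "basis_of_free_submonoid N X \<longleftrightarrow>
     X \<subseteq> carrier N \<and>
     word_value N \<in> iso (free_monoid X) (N\<lparr>carrier := submonoid_generated N X\<rparr>)"

section \<open>Special monoids\<close>

text \<open>Throughout, \<open>A\<close> is the alphabet, \<open>ws\<close> the list of defining words and \<open>r\<close> the strict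
  form \<open><\<close> of the total order on \<open>A\<close>.\<close>

definition special_rels :: "'a list list \<Rightarrow> ('a list \<times> 'a list) set" where
  "special_rels ws = {(w, []) | w. w \<in> set ws}"

definition special_monoid :: "'a set \<Rightarrow> 'a list list \<Rightarrow> 'a list set monoid" where
  "special_monoid A ws = presented_monoid A (special_rels ws)"

definition special_class :: "'a set \<Rightarrow> 'a list list \<Rightarrow> 'a list \<Rightarrow> 'a list set" where
  "special_class A ws u = word_class A (special_rels ws) u"

definition invertible_word :: "'a set \<Rightarrow> 'a list list \<Rightarrow> 'a list \<Rightarrow> bool" where
  "invertible_word A ws u \<longleftrightarrow>
     u \<in> lists A \<and> special_class A ws u \<in> Units (special_monoid A ws)"

definition indecomposable_word :: "'a set \<Rightarrow> 'a list list \<Rightarrow> 'a list \<Rightarrow> bool" where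
  "indecomposable_word A ws u \<longleftrightarrow>
     u \<noteq> [] \<and> invertible_word A ws u \<and>
     (\<forall>p. p \<noteq> [] \<and> strict_prefix p u \<longrightarrow> \<not> invertible_word A ws p)"

text \<open>Every invertible word has exactly one such factorisation (the empty one if it is empty).\<close>

definition indecomposable_factorisation ::
  "'a set \<Rightarrow> 'a list list \<Rightarrow> 'a list \<Rightarrow> 'a list list \<Rightarrow> bool" where
  "indecomposable_factorisation A ws u fs \<longleftrightarrow>
     concat fs = u \<and> (\<forall>f\<in>set fs. indecomposable_word A ws f)"

text \<open>If \<open>ws\<close> is empty, the last conjunct is false, so the value of \<open>Max {}\<close> is immaterial.\<close>

definition Delta :: "'a set \<Rightarrow> 'a list list \<Rightarrow> 'a list set" where
  "Delta A ws =
     {\<delta>. indecomposable_word A ws \<delta> \<and>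
         length \<delta> \<le> Max (length ` set ws) \<and>
         (\<exists>w\<in>set ws. \<exists>fs. indecomposable_factorisation A ws w fs \<and>
            (\<exists>f\<in>set fs. special_class A ws \<delta> = special_class A ws f))}"

text \<open>A pair \<open>(u, v)\<close> is the rule \<open>u \<rightarrow> v\<close>; \<open>concat ` lists D\<close> is the set of words in \<open>D\<^sup>*\<close>, and
  \<open>(v, u) \<in> lenlex r\<close> says that \<open>v\<close> is smaller than \<open>u\<close> in the short-lex order.\<close>

definition special_rewrites ::
  "'a set \<Rightarrow> 'a list list \<Rightarrow> ('a \<times> 'a) set \<Rightarrow> ('a list \<times> 'a list) set" where
  "special_rewrites A ws r =
     {(u, v). u \<in> concat ` lists (Delta A ws) \<and> v \<in> concat ` lists (Delta A ws) \<and>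
        special_class A ws u = special_class A ws v \<and> (v, u) \<in> lenlex r}"

definition reduced_word :: "'a set \<Rightarrow> 'a list list \<Rightarrow> ('a \<times> 'a) set \<Rightarrow> 'a list \<Rightarrow> bool" where
  "reduced_word A ws r x \<longleftrightarrow>
     x \<in> lists A \<and> \<not> (\<exists>(u, v) \<in> special_rewrites A ws r. sublist u x)"

text \<open>The choice is determined: every element of the monoid is represented by exactly one
  reduced word, because the rewriting system is complete.\<close>

definition inverse_word :: "'a set \<Rightarrow> 'a list list \<Rightarrow> ('a \<times> 'a) set \<Rightarrow> 'a list \<Rightarrow> 'a list" where
  "inverse_word A ws r u =
     (SOME v. reduced_word A ws r v \<and>
        special_class A ws v = inv\<^bsub>special_monoid A ws\<^esub> (special_class A ws u))"

text \<open>An occurrence in \<open>u @ v\<close> of a word that cuts across \<open>(u, v)\<close> is encoded as the pair of the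
  suffix of \<open>u\<close> and the prefix of \<open>v\<close> that it covers; this pair determines its position.\<close>

definition cutting_occurrences ::
  "'a set \<Rightarrow> 'a list list \<Rightarrow> 'a list \<Rightarrow> 'a list \<Rightarrow> ('a list \<times> 'a list) set" where
  "cutting_occurrences A ws u v =
     {(u2, v1). u2 \<noteq> [] \<and> v1 \<noteq> [] \<and> suffix u2 u \<and> prefix v1 v \<and> invertible_word A ws (u2 @ v1)}"

definition occurrence_inclusion :: "(('a list \<times> 'a list) \<times> ('a list \<times> 'a list)) set" where
  "occurrence_inclusion = {((p, q), (p', q')). suffix p p' \<and> prefix q q'}"

text \<open>Only meaningful if \<open>cutting_occurrences A ws u v\<close> is nonempty.\<close>

definition height :: "'a set \<Rightarrow> 'a list list \<Rightarrow> 'a list \<Rightarrow> 'a list \<Rightarrow> nat" where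
  "height A ws u v =
     Max {card K - 1 | K. K \<noteq> {} \<and> K \<subseteq> cutting_occurrences A ws u v \<and>
                          K \<in> Chains occurrence_inclusion}"

definition no_invertible_suffix :: "'a set \<Rightarrow> 'a list list \<Rightarrow> 'a list \<Rightarrow> bool" where
  "no_invertible_suffix A ws u \<longleftrightarrow> (\<forall>s. s \<noteq> [] \<and> suffix s u \<longrightarrow> \<not> invertible_word A ws s)"

section \<open>The monoid of one-sided inverse pairs\<close>

definition inverse_pairs :: "('a, 'm) monoid_scheme \<Rightarrow> ('a \<times> 'a) monoid" where
  "inverse_pairs M =
     \<lparr>carrier = {(u, v). u \<in> carrier M \<and> v \<in> carrier M \<and> u \<otimes>\<^bsub>M\<^esub> v = \<one>\<^bsub>M\<^esub>},
      mult = (\<lambda>(a, b) (x, y). (a \<otimes>\<^bsub>M\<^esub> x, y \<otimes>\<^bsub>M\<^esub> b)),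
      one = (\<one>\<^bsub>M\<^esub>, \<one>\<^bsub>M\<^esub>)\<rparr>"

definition Y_gens ::
  "'a set \<Rightarrow> 'a list list \<Rightarrow> ('a \<times> 'a) set \<Rightarrow> ('a list set \<times> 'a list set) set" where
  "Y_gens A ws r =
     {(special_class A ws \<delta>, special_class A ws (inverse_word A ws r \<delta>)) | \<delta>. \<delta> \<in> Delta A ws}"

definition X_gens ::
  "'a set \<Rightarrow> 'a list list \<Rightarrow> ('a \<times> 'a) set \<Rightarrow> ('a list set \<times> 'a list set) set" where
  "X_gens A ws r =
     {(special_class A ws \<delta>1, special_class A ws (\<delta>2 @ inverse_word A ws r (\<delta>1 @ \<delta>2))) | \<delta>1 \<delta>2.
        \<delta>1 \<noteq> [] \<and> \<delta>2 \<noteq> [] \<and> reduced_word A ws r \<delta>1 \<and> reduced_word A ws r \<delta>2 \<and>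
        invertible_word A ws (\<delta>1 @ \<delta>2) \<and>
        height A ws \<delta>1 \<delta>2 = 0 \<and>
        no_invertible_suffix A ws \<delta>1}"

end

theory Submission
  imports Defs
begin

text \<open>In a special monoid a word that is both a suffix of an invertible word and a prefix of another
  one is invertible. Hence the overlaps of left-hand sides in Zhang's rewriting system split into
  words over \<open>\<Delta>\<close> and resolve, and reduced words are unique representatives.

  If \<open>(u, v)\<close> is in \<open>N\<close> with \<open>u\<close> and \<open>v\<close> reduced, then a minimal invertible word \<open>s p\<close> across the
  boundary of \<open>u v\<close> splits off the generator \<open>(s, p (s p)\<^sup>-\<^sup>1)\<close> from the right, so \<open>N\<close> is generated by \<open>G\<close>
  and \<open>X\<close>. Conversely, in a product \<open>g\<^sub>0 x\<^sub>1 g\<^sub>1 \<dots> x\<^sub>n g\<^sub>n\<close> the reduced words representing the factors can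
  be chosen so that no rule applies across their boundaries, on both components. Comparing the
  resulting reduced words from the outside inwards determines \<open>g\<^sub>0\<close>, then \<open>x\<^sub>1\<close>, and so on; two
  generators whose first components have different lengths cannot match, because the longer one
  would then be cut across by a proper invertible factor or end in an invertible word.\<close>

text \<open>The two sides of a generator are not symmetric, and this shapes the uniqueness proof.
  For a unit \<open>b\<close>, cutting \<open>d1 b c\<close> after \<open>b\<close> instead of
  before it changes the pair only by the right factor (\<open>b\<close>,
  \<open>b\<^sup>-\<^sup>1\<close>); condition (4) pushes such units into \<open>d2\<close>. Hence
  \<open>d1 u\<close> is reduced at once, but in the second component \<open>v d2 e\<close> the word
  \<open>v\<close> can react with an invertible prefix of \<open>d2\<close>. The longest such prefix
  \<open>b\<close> of \<open>d2 = b c\<close> is therefore absorbed first: with \<open>w\<close> the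
  reduced form of \<open>v b\<close>, the word \<open>w c e\<close> is reduced, and at the end
  \<open>b\<close> and \<open>v\<close> have to be recovered from \<open>w\<close>. The local
  arguments rest on one-sided invertibility. Suffixes of invertible words are left invertible,
  prefixes are right invertible, and in a pair (\<open>u\<close>, \<open>v\<close>) of
  \<open>N\<close> the word \<open>u\<close> is right and \<open>v\<close> left invertible. So an
  invertible word across a boundary tends to have an invertible part on one side. The rewriting
  system contains every decreasing pair of equal words over \<Delta>, so a critical pair is settled
  as soon as both results are known to be words over \<Delta>. The length bound in \<Delta> survives
  rewriting because rules never lengthen a word.\<close>

text \<open>As safe rules these turn membership in \<open>lists A\<close> into a bounded quantifier, so that facts
  stated with \<open>lists A\<close> no longer apply.\<close>

declare in_listsD [rule del] in_listsI [rule del]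

section \<open>Presented monoids and free products\<close>

lemma word_cong_in_lists:
  "(u, v) \<in> word_cong A R \<Longrightarrow> u \<in> lists A \<and> v \<in> lists A"
  by (induction rule: word_cong.induct) auto

lemma equiv_word_cong: "equiv (lists A) (word_cong A R)"
proof (rule equivI)
  show "word_cong A R \<subseteq> lists A \<times> lists A"
    using word_cong_in_lists by auto
  show "refl_on (lists A) (word_cong A R)"
    by (simp add: refl_on_def word_cong.refl)
  show "sym (word_cong A R)"
    by (rule symI) (rule word_cong.sym)
  show "trans (word_cong A R)"
    by (rule transI) (rule word_cong.trans)
qed

lemmas [trans] = word_cong.trans

lemma word_class_eq_iff:
  assumes "u \<in> lists A"
  shows "word_class A R u = word_class A R v \<longleftrightarrow> (u, v) \<in> word_cong A R"
proof
  assume "word_class A R u = word_class A R v"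
  moreover have "u \<in> word_class A R u"
    using assms by (simp add: word_class_def word_cong.refl)
  ultimately show "(u, v) \<in> word_cong A R"
    by (simp add: word_class_def word_cong.sym)
next
  assume "(u, v) \<in> word_cong A R"
  then show "word_class A R u = word_class A R v"
    unfolding word_class_def by (rule equiv_class_eq[OF equiv_word_cong])
qed

text \<open>This makes equality of classes meaningful for all lists: an equation with a class such
  as that of \<open>[]\<close> forces its words into \<open>lists A\<close>, and the congruence
  lemmas below need no membership hypotheses.\<close>

lemma word_class_eq_empty: "word_class A R u = {} \<longleftrightarrow> u \<notin> lists A"
  unfolding word_class_def by (auto intro: word_cong.refl dest: word_cong_in_lists)

lemma word_class_eq_lists:
  "word_class A R u = word_class A R v \<Longrightarrow> u \<in> lists A \<longleftrightarrow> v \<in> lists A"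
  using word_class_eq_empty by metis

lemma word_class_append_cong:
  assumes "word_class A R u = word_class A R u'" "word_class A R v = word_class A R v'"
  shows "word_class A R (u @ v) = word_class A R (u' @ v')"
proof (cases "u \<in> lists A \<and> v \<in> lists A")
  case True
  then show ?thesis
    using assms by (simp add: word_class_eq_iff word_cong.mult)
next
  case False
  then have "u @ v \<notin> lists A" "u' @ v' \<notin> lists A"
    using assms[THEN word_class_eq_lists] by auto
  then show ?thesis
    by (metis word_class_eq_empty)
qed

lemma carrier_presented_monoid: "carrier (presented_monoid A R) = word_class A R ` lists A"
  by (auto simp: presented_monoid_def quotient_def word_class_def)

lemma one_presented_monoid: "\<one>\<^bsub>presented_monoid A R\<^esub> = word_class A R []"
  by (simp add: presented_monoid_def)

lemma mult_presented_monoid: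
  assumes "u \<in> lists A" "v \<in> lists A"
  shows "word_class A R u \<otimes>\<^bsub>presented_monoid A R\<^esub> word_class A R v = word_class A R (u @ v)"
proof -
  have "word_class A R (p @ q) = word_class A R (u @ v)"
    if "p \<in> word_class A R u" "q \<in> word_class A R v" for p q
    using that assms
    by (intro word_class_append_cong) (simp_all add: word_class_eq_iff word_class_def word_cong.sym
        equiv_class_eq[OF equiv_word_cong])
  moreover have "u \<in> word_class A R u" "v \<in> word_class A R v"
    using assms by (auto simp: word_class_def word_cong.refl)
  ultimately have "(\<Union>p\<in>word_class A R u. \<Union>q\<in>word_class A R v. word_class A R (p @ q)) = word_class A R (u @ v)"
    by (metis (no_types, lifting) UN_constant_eq)
  then show ?thesis
    by (simp add: presented_monoid_def)
qed

lemma monoid_presented_monoid: "monoid (presented_monoid A R)"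
  by (rule monoidI)
    (auto simp: carrier_presented_monoid one_presented_monoid mult_presented_monoid)

section \<open>Generated submonoids and values of words\<close>

lemma submonoid_submonoid_generated:
  assumes "monoid N" "Y \<subseteq> carrier N"
  shows "submonoid (submonoid_generated N Y) N"
proof
  interpret monoid N by fact
  have "submonoid (carrier N) N"
    by unfold_locales auto
  then show "submonoid_generated N Y \<subseteq> carrier N"
    unfolding submonoid_generated_def using assms(2) by (intro hull_minimal)
  show "x \<otimes>\<^bsub>N\<^esub> y \<in> submonoid_generated N Y"
    if "x \<in> submonoid_generated N Y" "y \<in> submonoid_generated N Y" for x y
    using that by (auto simp: submonoid_generated_def hull_def intro: submonoid.m_closed)
  show "\<one>\<^bsub>N\<^esub> \<in> submonoid_generated N Y"
    by (auto simp: submonoid_generated_def hull_def intro: submonoid.one_closed)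
qed

lemma submonoid_generated_minimal:
  "Y \<subseteq> H \<Longrightarrow> submonoid H N \<Longrightarrow> submonoid_generated N Y \<subseteq> H"
  unfolding submonoid_generated_def by (rule hull_minimal)

lemma submonoid_generated_inc: "y \<in> Y \<Longrightarrow> y \<in> submonoid_generated N Y"
  unfolding submonoid_generated_def by (rule hull_inc)

lemma word_value_simps [simp]:
  "word_value N [] = \<one>\<^bsub>N\<^esub>"
  "word_value N (x # xs) = x \<otimes>\<^bsub>N\<^esub> word_value N xs"
  by (simp_all add: word_value_def)

lemma (in monoid) word_value_closed [simp]: "xs \<in> lists (carrier G) \<Longrightarrow> word_value G xs \<in> carrier G"
  by (induction xs) auto

lemma (in monoid) word_value_append:
  "xs \<in> lists (carrier G) \<Longrightarrow> ys \<in> lists (carrier G) \<Longrightarrow>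
    word_value G (xs @ ys) = word_value G xs \<otimes> word_value G ys"
  by (induction xs) (auto simp: m_assoc)

text \<open>The isomorphism is built from the free product to \<open>N\<close>, while the theorem
  asks for the opposite direction.\<close>

lemma monoid_iso_sym:
  assumes "monoid G" "\<phi> \<in> iso G H"
  shows "inv_into (carrier G) \<phi> \<in> iso H G"
proof -
  interpret monoid G by fact
  let ?\<psi> = "inv_into (carrier G) \<phi>"
  have bij: "bij_betw \<phi> (carrier G) (carrier H)" and hom: "\<phi> \<in> hom G H"
    using assms by (auto simp: iso_def)
  note inv = bij_betw_inv_into[OF bij]
  have "?\<psi> (x \<otimes>\<^bsub>H\<^esub> y) = ?\<psi> x \<otimes>\<^bsub>G\<^esub> ?\<psi> y" if "x \<in> carrier H" "y \<in> carrier H" for x y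
  proof -
    have x: "?\<psi> x \<in> carrier G" "\<phi> (?\<psi> x) = x" and y: "?\<psi> y \<in> carrier G" "\<phi> (?\<psi> y) = y"
      using that inv bij_betw_inv_into_right[OF bij] by (auto simp: bij_betw_def)
    then have "\<phi> (?\<psi> x \<otimes>\<^bsub>G\<^esub> ?\<psi> y) = x \<otimes>\<^bsub>H\<^esub> y"
      using hom by (simp add: hom_mult)
    then show ?thesis
      using bij x y by (metis bij_betw_inv_into_left m_closed)
  qed
  then show ?thesis
    using inv by (auto simp: iso_def hom_def bij_betw_def)
qed

text \<open>Uniqueness of one factorisation step \<open>m \<mapsto> \<iota> g \<cdot> x \<cdot> m'\<close> with an arbitrary remainder \<open>m'\<close> is
  enough: iterating it gives uniqueness of alternating products.\<close>

locale free_product_factorisation = N: monoid N + G: monoid G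
  for N :: "('n, 'q) monoid_scheme" and G :: "('g, 'p) monoid_scheme" +
  fixes \<iota> :: "'g \<Rightarrow> 'n" and X :: "'n set"
  assumes hom_\<iota>: "\<iota> \<in> hom G N" "\<iota> \<one>\<^bsub>G\<^esub> = \<one>\<^bsub>N\<^esub>"
    and inj_\<iota>: "inj_on \<iota> (carrier G)"
    and X_carrier: "X \<subseteq> carrier N"
    and factorisation_unique: "\<lbrakk>g \<in> carrier G; g' \<in> carrier G; x \<in> X; x' \<in> X; m \<in> carrier N; m' \<in> carrier N;
      \<iota> g \<otimes>\<^bsub>N\<^esub> (x \<otimes>\<^bsub>N\<^esub> m) = \<iota> g' \<otimes>\<^bsub>N\<^esub> (x' \<otimes>\<^bsub>N\<^esub> m')\<rbrakk> \<Longrightarrow> g = g' \<and> x = x' \<and> m = m'"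
    and no_factorisation: "\<lbrakk>g \<in> carrier G; g' \<in> carrier G; x \<in> X; m \<in> carrier N\<rbrakk> \<Longrightarrow>
      \<iota> g \<noteq> \<iota> g' \<otimes>\<^bsub>N\<^esub> (x \<otimes>\<^bsub>N\<^esub> m)"
    and generated: "submonoid_generated N (\<iota> ` carrier G \<union> X) = carrier N"
begin

abbreviation "letters \<equiv> carrier G <+> lists X"
abbreviation "rels \<equiv> free_product_rels G (free_monoid X)"

lemma free_product_eq: "free_product G (free_monoid X) = presented_monoid letters rels"
  by (simp add: free_product_def free_monoid_def)

lemma \<iota>_closed [simp]: "g \<in> carrier G \<Longrightarrow> \<iota> g \<in> carrier N"
  using hom_\<iota> by (auto simp: hom_def)

lemma X_closed [simp]: "x \<in> X \<Longrightarrow> x \<in> carrier N"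
  using X_carrier by auto

lemma lists_X_closed [simp]: "xs \<in> lists X \<Longrightarrow> xs \<in> lists (carrier N)"
  using lists_mono[OF X_carrier] by blast

text \<open>With trivial unit factors the two axioms specialise to \<open>X\<close> alone; this and
  the next lemma give freeness of \<open>X\<close>.\<close>

lemma X_mult_ne_one: "x \<in> X \<Longrightarrow> m \<in> carrier N \<Longrightarrow> x \<otimes>\<^bsub>N\<^esub> m \<noteq> \<one>\<^bsub>N\<^esub>"
  using no_factorisation[of "\<one>\<^bsub>G\<^esub>" "\<one>\<^bsub>G\<^esub>" x m] hom_\<iota> by auto

lemma X_mult_cancel:
  "\<lbrakk>x \<in> X; x' \<in> X; m \<in> carrier N; m' \<in> carrier N; x \<otimes>\<^bsub>N\<^esub> m = x' \<otimes>\<^bsub>N\<^esub> m'\<rbrakk> \<Longrightarrow> x = x' \<and> m = m'"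
  using factorisation_unique[of "\<one>\<^bsub>G\<^esub>" "\<one>\<^bsub>G\<^esub>" x x' m m'] hom_\<iota> by simp

lemma word_value_cancel:
  "\<lbrakk>xs \<in> lists X; ys \<in> lists X; word_value N xs = word_value N ys\<rbrakk> \<Longrightarrow> xs = ys"
proof (induction xs arbitrary: ys)
  case Nil
  then show ?case
    by (cases ys) (auto simp: X_mult_ne_one[symmetric])
next
  case (Cons x xs)
  show ?case
  proof (cases ys)
    case Nil
    then show ?thesis
      using Cons.prems by (auto simp: X_mult_ne_one)
  next
    case (Cons y zs)
    then show ?thesis
      using Cons.prems Cons.IH[of zs] X_mult_cancel[of x y "word_value N xs" "word_value N zs"]
      by auto
  qed
qed

lemma word_value_image: "word_value N ` lists X = submonoid_generated N X"
proof
  have "submonoid (word_value N ` lists X) N"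
  proof
    show "word_value N ` lists X \<subseteq> carrier N"
      by auto
    show "a \<otimes>\<^bsub>N\<^esub> b \<in> word_value N ` lists X"
      if ab: "a \<in> word_value N ` lists X" "b \<in> word_value N ` lists X" for a b
    proof -
      obtain xs where "a = word_value N xs" "xs \<in> lists X"
        using ab(1) by (rule imageE)
      moreover obtain ys where "b = word_value N ys" "ys \<in> lists X"
        using ab(2) by (rule imageE)
      ultimately have "a \<otimes>\<^bsub>N\<^esub> b = word_value N (xs @ ys)" "xs @ ys \<in> lists X"
        by (auto simp: N.word_value_append)
      then show ?thesis
        by blast
    qed
    show "\<one>\<^bsub>N\<^esub> \<in> word_value N ` lists X"
      by (rule image_eqI[of _ _ "[]"]) simp_all
  qed
  moreover have "X \<subseteq> word_value N ` lists X"
    by (auto intro!: image_eqI[of _ _ "[_]"])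
  ultimately show "submonoid_generated N X \<subseteq> word_value N ` lists X"
    by (intro submonoid_generated_minimal)
  interpret S: submonoid "submonoid_generated N X" N
    by (rule submonoid_submonoid_generated) (auto intro: N.monoid_axioms)
  have "xs \<in> lists X \<Longrightarrow> word_value N xs \<in> submonoid_generated N X" for xs
    by (induction xs) (auto intro: submonoid_generated_inc)
  then show "word_value N ` lists X \<subseteq> submonoid_generated N X"
    by auto
qed

lemma basis: "basis_of_free_submonoid N X"
  unfolding basis_of_free_submonoid_def iso_def hom_def bij_betw_def
  using X_carrier word_value_image
  by (auto simp: free_monoid_def N.word_value_append inj_on_def word_value_cancel)

section \<open>Evaluation of the free product and alternating normal forms\<close>

definition letter_value :: "'g + 'n list \<Rightarrow> 'n" where
  "letter_value = case_sum \<iota> (word_value N)"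

definition evaluate :: "('g + 'n list) list \<Rightarrow> 'n" where
  "evaluate w = word_value N (map letter_value w)"

lemma letter_value_simps [simp]:
  "letter_value (Inl g) = \<iota> g" "letter_value (Inr xs) = word_value N xs"
  by (simp_all add: letter_value_def)

lemma evaluate_simps [simp]:
  "evaluate [] = \<one>\<^bsub>N\<^esub>" "evaluate (a # w) = letter_value a \<otimes>\<^bsub>N\<^esub> evaluate w"
  by (simp_all add: evaluate_def)

lemma letter_value_closed: "a \<in> letters \<Longrightarrow> letter_value a \<in> carrier N"
  by auto

lemma map_letter_value_closed: "w \<in> lists letters \<Longrightarrow> map letter_value w \<in> lists (carrier N)"
  using letter_value_closed by (auto simp: in_lists_conv_set)

lemma evaluate_closed [simp]: "w \<in> lists letters \<Longrightarrow> evaluate w \<in> carrier N"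
  unfolding evaluate_def by (intro N.word_value_closed map_letter_value_closed)

lemma evaluate_append:
  "v \<in> lists letters \<Longrightarrow> w \<in> lists letters \<Longrightarrow> evaluate (v @ w) = evaluate v \<otimes>\<^bsub>N\<^esub> evaluate w"
  unfolding evaluate_def map_append
  by (intro N.word_value_append map_letter_value_closed)

lemma evaluate_cong: "(v, w) \<in> word_cong letters rels \<Longrightarrow> evaluate v = evaluate w"
proof (induction rule: word_cong.induct)
  case (base u v)
  then show ?case
    by (auto simp: free_product_rels_def free_monoid_def hom_\<iota> hom_mult[OF hom_\<iota>(1)] N.word_value_append)
next
  case (mult u u' v v')
  then show ?case
    using word_cong_in_lists[OF mult(1)] word_cong_in_lists[OF mult(2)] by (simp add: evaluate_append)
qed auto

text \<open>The normal form
  \<open>g\<^sub>0 x\<^sub>1 g\<^sub>1 \<dots> x\<^sub>n g\<^sub>n\<close>. Trivial elements of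
  \<open>G\<close> are kept and each \<open>x\<close> is a letter of its own, so that the shape is
  rigid and two such words can be compared layer by layer.\<close>

fun alternating :: "'g \<Rightarrow> ('n \<times> 'g) list \<Rightarrow> ('g + 'n list) list" where
  "alternating g [] = [Inl g]"
| "alternating g ((x, h) # s) = Inl g # Inr [x] # alternating h s"

lemma alternating_in_lists:
  "g \<in> carrier G \<Longrightarrow> s \<in> lists (X \<times> carrier G) \<Longrightarrow> alternating g s \<in> lists letters"
  by (induction g s rule: alternating.induct) auto

text \<open>One layer is peeled off at a time, with the value of the rest as the remainder
  \<open>m\<close> of \<open>factorisation_unique\<close>; \<open>no_factorisation\<close> rules out
  that one word stops earlier.\<close>

lemma evaluate_alternating_inj:
  "\<lbrakk>g \<in> carrier G; s \<in> lists (X \<times> carrier G); g' \<in> carrier G; s' \<in> lists (X \<times> carrier G);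
    evaluate (alternating g s) = evaluate (alternating g' s')\<rbrakk> \<Longrightarrow> g = g' \<and> s = s'"
proof (induction g s arbitrary: g' s' rule: alternating.induct)
  case (1 g)
  show ?case
  proof (cases s')
    case Nil
    then show ?thesis
      using 1 inj_\<iota> by (auto simp: inj_on_def)
  next
    case (Cons a t)
    obtain x h where "a = (x, h)"
      by fastforce
    then show ?thesis
      using 1 Cons no_factorisation[of g g' x "evaluate (alternating h t)"]
      by (auto simp: alternating_in_lists)
  qed
next
  case (2 g x h s)
  show ?case
  proof (cases s')
    case Nil
    then show ?thesis
      using 2 no_factorisation[of g' g x "evaluate (alternating h s)"]
      by (auto simp: alternating_in_lists)
  next
    case (Cons a t)
    obtain x' h' where "a = (x', h')"
      by fastforce
    then show ?thesis
      using 2 Cons factorisation_unique[of g g' x x' "evaluate (alternating h s)" "evaluate (alternating h' t)"]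
      by (auto simp: alternating_in_lists)
  qed
qed

text \<open>A normal form always begins with an \<open>Inl\<close> letter, so one entry of the
  multiplication table of \<open>G\<close> absorbs the new letter.\<close>

lemma Inl_alternating:
  assumes "g \<in> carrier G" "h \<in> carrier G" "s \<in> lists (X \<times> carrier G)"
  shows "(Inl g # alternating h s, alternating (g \<otimes>\<^bsub>G\<^esub> h) s) \<in> word_cong letters rels"
proof -
  obtain t where t: "alternating h s = Inl h # t" "alternating (g \<otimes>\<^bsub>G\<^esub> h) s = Inl (g \<otimes>\<^bsub>G\<^esub> h) # t"
    by (cases s) auto
  have "([Inl g, Inl h], [Inl (g \<otimes>\<^bsub>G\<^esub> h)]) \<in> word_cong letters rels"
    using assms by (intro word_cong.base) (auto simp: free_product_rels_def)
  moreover have "(t, t) \<in> word_cong letters rels"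
    using alternating_in_lists[OF assms(2,3)] t by (auto intro: word_cong.refl)
  ultimately have "([Inl g, Inl h] @ t, [Inl (g \<otimes>\<^bsub>G\<^esub> h)] @ t) \<in> word_cong letters rels"
    by (rule word_cong.mult)
  then show ?thesis
    using t by simp
qed

lemma Inl_one: "([Inl \<one>\<^bsub>G\<^esub>], []) \<in> word_cong letters rels"
  by (intro word_cong.base) (auto simp: free_product_rels_def)

text \<open>A letter from the free monoid is broken into single generators, and an
  \<open>Inl\<close> letter for the unit of \<open>G\<close> is inserted before each of
  them.\<close>

lemma Inr_alternating:
  assumes "xs \<in> lists X" "h \<in> carrier G" "s \<in> lists (X \<times> carrier G)"
  shows "\<exists>g\<in>carrier G. \<exists>t\<in>lists (X \<times> carrier G).
    (Inr xs # alternating h s, alternating g t) \<in> word_cong letters rels"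
  using assms(1)
proof (induction xs)
  case Nil
  have "([Inr []], []) \<in> word_cong letters rels"
    by (intro word_cong.base) (auto simp: free_product_rels_def free_monoid_def)
  from word_cong.mult[OF this word_cong.refl[OF alternating_in_lists[OF assms(2,3)]]]
  show ?case
    using assms by auto
next
  case (Cons x xs)
  then obtain g t where gt: "g \<in> carrier G" "t \<in> lists (X \<times> carrier G)"
    and IH: "(Inr xs # alternating h s, alternating g t) \<in> word_cong letters rels"
    by auto
  have x: "x \<in> X" "[Inr [x]] \<in> lists letters"
    using Cons by auto
  have "([Inr [x], Inr xs], [Inr (x # xs)]) \<in> word_cong letters rels"
    using Cons by (intro word_cong.base)
      (force simp: free_product_rels_def free_monoid_def)+
  from word_cong.sym[OF word_cong.mult[OF this word_cong.refl[OF alternating_in_lists[OF assms(2,3)]]]]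
  have "(Inr (x # xs) # alternating h s, Inr [x] # Inr xs # alternating h s) \<in> word_cong letters rels"
    by simp
  also have "(Inr [x] # Inr xs # alternating h s, Inr [x] # alternating g t) \<in> word_cong letters rels"
    using word_cong.mult[OF word_cong.refl[OF x(2)] IH] by simp
  also have "(Inr [x] # alternating g t, Inl \<one>\<^bsub>G\<^esub> # Inr [x] # alternating g t) \<in> word_cong letters rels"
    using word_cong.mult[OF Inl_one word_cong.refl[of "Inr [x] # alternating g t"]]
      alternating_in_lists[OF gt] x by (auto intro: word_cong.sym)
  finally show ?case
    using gt x by (intro bexI[of _ "\<one>\<^bsub>G\<^esub>"] bexI[of _ "(x, g) # t"]) auto
qed

lemma ex_alternating:
  "w \<in> lists letters \<Longrightarrow>
    \<exists>g\<in>carrier G. \<exists>s\<in>lists (X \<times> carrier G). (w, alternating g s) \<in> word_cong letters rels"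
proof (induction w)
  case Nil
  show ?case
    using Inl_one by (intro bexI[of _ "\<one>\<^bsub>G\<^esub>"] bexI[of _ "[]"]) (auto intro: word_cong.sym)
next
  case (Cons a w)
  then obtain h s where hs: "h \<in> carrier G" "s \<in> lists (X \<times> carrier G)"
    and IH: "(w, alternating h s) \<in> word_cong letters rels"
    by auto
  have "[a] \<in> lists letters"
    using Cons by auto
  from word_cong.mult[OF word_cong.refl[OF this] IH]
  have step: "(a # w, a # alternating h s) \<in> word_cong letters rels"
    by simp
  show ?case
  proof (cases a)
    case (Inl g)
    then have "g \<in> carrier G"
      using Cons by auto
    then show ?thesis
      using Inl_alternating[of g h s] hs step Inl
      by (metis G.m_closed word_cong.trans)
  next
    case (Inr xs)
    then have "xs \<in> lists X"
      using Cons by auto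
    then show ?thesis
      using Inr_alternating[of xs h s] hs step Inr by (metis word_cong.trans)
  qed
qed

text \<open>Both words are congruent to normal forms with the same value, and these
  coincide.\<close>

lemma evaluate_eq_imp_cong:
  assumes "v \<in> lists letters" "w \<in> lists letters" "evaluate v = evaluate w"
  shows "(v, w) \<in> word_cong letters rels"
proof -
  obtain g s where gs: "g \<in> carrier G" "s \<in> lists (X \<times> carrier G)"
    "(v, alternating g s) \<in> word_cong letters rels"
    using ex_alternating assms by blast
  obtain h t where ht: "h \<in> carrier G" "t \<in> lists (X \<times> carrier G)"
    "(w, alternating h t) \<in> word_cong letters rels"
    using ex_alternating assms by blast
  have "g = h \<and> s = t"
    using evaluate_alternating_inj gs ht evaluate_cong assms by metis
  then show ?thesis
    using gs ht by (metis word_cong.sym word_cong.trans)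
qed

lemma evaluate_image: "evaluate ` lists letters = carrier N"
proof
  have "submonoid (evaluate ` lists letters) N"
  proof
    show "evaluate ` lists letters \<subseteq> carrier N"
      using evaluate_closed by blast
    show "a \<otimes>\<^bsub>N\<^esub> b \<in> evaluate ` lists letters"
      if ab: "a \<in> evaluate ` lists letters" "b \<in> evaluate ` lists letters" for a b
    proof -
      obtain v where "a = evaluate v" "v \<in> lists letters"
        using ab(1) by (rule imageE)
      moreover obtain w where "b = evaluate w" "w \<in> lists letters"
        using ab(2) by (rule imageE)
      ultimately have "a \<otimes>\<^bsub>N\<^esub> b = evaluate (v @ w)" "v @ w \<in> lists letters"
        by (auto simp: evaluate_append)
      then show ?thesis
        by blast
    qed
    show "\<one>\<^bsub>N\<^esub> \<in> evaluate ` lists letters"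
      by (rule image_eqI[of _ _ "[]"]) simp_all
  qed
  moreover have "\<iota> ` carrier G \<union> X \<subseteq> evaluate ` lists letters"
  proof -
    have "\<iota> g = evaluate [Inl g] \<and> [Inl g] \<in> lists letters" if "g \<in> carrier G" for g
      using that by auto
    moreover have "x = evaluate [Inr [x]] \<and> [Inr [x]] \<in> lists letters" if "x \<in> X" for x
      using that by auto
    ultimately show ?thesis
      by blast
  qed
  ultimately show "carrier N \<subseteq> evaluate ` lists letters"
    using submonoid_generated_minimal generated by metis
qed (use evaluate_closed in blast)

text \<open>The representative chosen by \<open>SOME\<close> does not matter, by
  \<open>evaluate_cong\<close>.\<close>

definition free_product_map :: "('g + 'n list) list set \<Rightarrow> 'n" where
  "free_product_map P = evaluate (SOME w. w \<in> P)"

lemma free_product_map_class: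
  assumes "w \<in> lists letters"
  shows "free_product_map (word_class letters rels w) = evaluate w"
proof -
  have "w \<in> word_class letters rels w"
    using assms by (simp add: word_class_def word_cong.refl)
  then have "(SOME v. v \<in> word_class letters rels w) \<in> word_class letters rels w"
    by (rule someI)
  then show ?thesis
    unfolding free_product_map_def by (metis Image_singleton_iff evaluate_cong word_class_def)
qed

lemma free_product_map_iso: "free_product_map \<in> iso (free_product G (free_monoid X)) N"
proof -
  have "bij_betw free_product_map (word_class letters rels ` lists letters) (carrier N)"
    unfolding bij_betw_def
  proof
    show "inj_on free_product_map (word_class letters rels ` lists letters)"
      by (auto simp: inj_on_def free_product_map_class word_class_eq_iff evaluate_eq_imp_cong)
    show "free_product_map ` word_class letters rels ` lists letters = carrier N"
      unfolding image_image evaluate_image[symmetric]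
      by (rule image_cong[OF HOL.refl free_product_map_class])
  qed
  moreover have "free_product_map \<in> hom (presented_monoid letters rels) N"
  proof (rule homI)
    fix P assume "P \<in> carrier (presented_monoid letters rels)"
    then show "free_product_map P \<in> carrier N"
      using free_product_map_class evaluate_closed unfolding carrier_presented_monoid by force
  next
    fix P Q
    assume "P \<in> carrier (presented_monoid letters rels)" "Q \<in> carrier (presented_monoid letters rels)"
    then obtain v w where "v \<in> lists letters" "w \<in> lists letters"
      "P = word_class letters rels v" "Q = word_class letters rels w"
      unfolding carrier_presented_monoid by blast
    moreover from this have "v @ w \<in> lists letters"
      by auto
    ultimately show "free_product_map (P \<otimes>\<^bsub>presented_monoid letters rels\<^esub> Q) =
      free_product_map P \<otimes>\<^bsub>N\<^esub> free_product_map Q"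
      by (simp add: mult_presented_monoid free_product_map_class evaluate_append)
  qed
  ultimately show ?thesis
    unfolding free_product_eq iso_def carrier_presented_monoid by simp
qed

lemma free_product_map_inl:
  assumes "g \<in> carrier G"
  shows "free_product_map (free_product_inl G (free_monoid X) g) = \<iota> g"
proof -
  have "[Inl g] \<in> lists letters"
    using assms by auto
  from free_product_map_class[OF this] show ?thesis
    using assms by (simp add: free_product_inl_def free_monoid_def)
qed

lemma free_product_map_inr:
  assumes "x \<in> X"
  shows "free_product_map (free_product_inr G (free_monoid X) [x]) = x"
proof -
  have "[Inr [x]] \<in> lists letters"
    using assms by auto
  from free_product_map_class[OF this] show ?thesis
    using assms by (simp add: free_product_inr_def free_monoid_def)
qed

end

section \<open>Invertible words in special monoids\<close>

text \<open>Levi's lemma; all comparisons of two factorisations of a word below are instances of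
  it.\<close>

lemma append_eq_appendE:
  assumes "u @ v = x @ y"
  obtains t where "u = x @ t" "y = t @ v" | t where "x = u @ t" "v = t @ y"
  using iffD1[OF append_eq_append_conv2 assms] by blast

locale special_presentation =
  fixes A :: "'a set" and ws :: "'a list list" and r :: "('a \<times> 'a) set"
  assumes finite_A: "finite A"
    and order_r: "strict_linear_order_on A r"
    and ws_A: "set ws \<subseteq> lists A"
begin

abbreviation "cls \<equiv> special_class A ws"
abbreviation "M \<equiv> special_monoid A ws"
abbreviation "iv \<equiv> invertible_word A ws"
abbreviation "red \<equiv> reduced_word A ws r"

definition D :: "'a list set" where
  "D = concat ` lists (Delta A ws)"

text \<open>No membership of the witness has to be required: \<open>cls (v @ u) = cls []\<close>
  already puts both words into \<open>lists A\<close>.\<close>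

definition linv :: "'a list \<Rightarrow> bool" where
  "linv u \<longleftrightarrow> (\<exists>v. cls (v @ u) = cls [])"

definition rinv :: "'a list \<Rightarrow> bool" where
  "rinv u \<longleftrightarrow> (\<exists>v. cls (u @ v) = cls [])"

section \<open>Calculating with classes of words\<close>

lemma cls_append: "cls u = cls u' \<Longrightarrow> cls v = cls v' \<Longrightarrow> cls (u @ v) = cls (u' @ v')"
  unfolding special_class_def by (rule word_class_append_cong)

lemma cls_context: "cls u = cls u' \<Longrightarrow> cls (x @ u @ y) = cls (x @ u' @ y)"
  by (intro cls_append HOL.refl)

lemma cls_lists: "cls u = cls v \<Longrightarrow> u \<in> lists A \<longleftrightarrow> v \<in> lists A"
  unfolding special_class_def by (rule word_class_eq_lists)

lemma cls_Nil_lists: "cls u = cls [] \<Longrightarrow> u \<in> lists A"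
  using cls_lists by auto

lemma cls_insert: "cls m = cls [] \<Longrightarrow> cls (x @ m @ y) = cls (x @ y)"
  using cls_context[of m "[]" x y] by simp

lemma monoid_M: "monoid M"
  unfolding special_monoid_def by (rule monoid_presented_monoid)

lemma carrier_M: "carrier M = cls ` lists A"
  by (simp add: special_monoid_def carrier_presented_monoid special_class_def)

lemma cls_in_M [simp]: "u \<in> lists A \<Longrightarrow> cls u \<in> carrier M"
  by (simp add: carrier_M)

lemma one_M: "\<one>\<^bsub>M\<^esub> = cls []"
  by (simp add: special_monoid_def one_presented_monoid special_class_def)

lemma mult_M: "u \<in> lists A \<Longrightarrow> v \<in> lists A \<Longrightarrow> cls u \<otimes>\<^bsub>M\<^esub> cls v = cls (u @ v)"
  by (simp add: special_monoid_def mult_presented_monoid special_class_def)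

lemma iv_iff: "iv u \<longleftrightarrow> (\<exists>v. cls (u @ v) = cls [] \<and> cls (v @ u) = cls [])"
proof
  assume "iv u"
  then obtain x where u: "u \<in> lists A" and "x \<in> carrier M" "x \<otimes>\<^bsub>M\<^esub> cls u = \<one>\<^bsub>M\<^esub>" "cls u \<otimes>\<^bsub>M\<^esub> x = \<one>\<^bsub>M\<^esub>"
    unfolding invertible_word_def Units_def by auto
  moreover from this obtain v where "v \<in> lists A" "x = cls v"
    unfolding carrier_M by blast
  ultimately show "\<exists>v. cls (u @ v) = cls [] \<and> cls (v @ u) = cls []"
    by (auto simp: mult_M one_M)
next
  assume "\<exists>v. cls (u @ v) = cls [] \<and> cls (v @ u) = cls []"
  then obtain v where v: "cls (u @ v) = cls []" "cls (v @ u) = cls []"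
    by blast
  then have "u \<in> lists A" "v \<in> lists A"
    using cls_Nil_lists[OF v(1)] by auto
  with v show "iv u"
    unfolding invertible_word_def Units_def by (auto intro!: bexI[of _ "cls v"] simp: mult_M one_M)
qed

lemma iv_iff_linv_rinv: "iv u \<longleftrightarrow> linv u \<and> rinv u"
proof
  assume "linv u \<and> rinv u"
  then obtain v w where v: "cls (v @ u) = cls []" and w: "cls (u @ w) = cls []"
    unfolding linv_def rinv_def by blast
  \<comment> \<open>Both sides equal \<open>cls (v @ u @ w)\<close>.\<close>
  have "cls v = cls w"
    using cls_insert[OF v, of "[]" w] cls_insert[OF w, of v "[]"] by simp
  then have "cls (u @ w) = cls (u @ v)"
    using cls_append by metis
  then show "iv u"
    unfolding iv_iff using v w by metis
qed (auto simp: iv_iff linv_def rinv_def)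

lemma iv_linv: "iv u \<Longrightarrow> linv u" and iv_rinv: "iv u \<Longrightarrow> rinv u"
  by (simp_all add: iv_iff_linv_rinv)

lemma ivI: "linv u \<Longrightarrow> rinv u \<Longrightarrow> iv u"
  by (simp add: iv_iff_linv_rinv)

lemma iv_lists: "iv u \<Longrightarrow> u \<in> lists A"
  by (simp add: invertible_word_def)

lemma linv_lists: "linv u \<Longrightarrow> u \<in> lists A"
  by (auto simp: linv_def dest: cls_Nil_lists)

lemma linv_cong: "cls u = cls v \<Longrightarrow> linv u \<longleftrightarrow> linv v"
  unfolding linv_def using cls_append[OF HOL.refl] by metis

lemma rinv_cong: "cls u = cls v \<Longrightarrow> rinv u \<longleftrightarrow> rinv v"
  unfolding rinv_def using cls_append[OF _ HOL.refl] by metis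

lemma iv_cong: "cls u = cls v \<Longrightarrow> iv u \<longleftrightarrow> iv v"
  using linv_cong rinv_cong iv_iff_linv_rinv by metis

lemma rinv_appendD: "rinv (u @ v) \<Longrightarrow> rinv u"
  unfolding rinv_def by auto

lemma linv_appendD: "linv (u @ v) \<Longrightarrow> linv v"
  unfolding linv_def by (metis append_assoc)

lemma rinv_append: "rinv u \<Longrightarrow> rinv v \<Longrightarrow> rinv (u @ v)"
proof -
  assume "rinv u" "rinv v"
  then obtain u' v' where u: "cls (u @ u') = cls []" and v: "cls (v @ v') = cls []"
    unfolding rinv_def by blast
  have "cls ((u @ v) @ v' @ u') = cls []"
    using cls_insert[OF v, of u u'] u by simp
  then show ?thesis
    unfolding rinv_def by blast
qed

lemma linv_append: "linv u \<Longrightarrow> linv v \<Longrightarrow> linv (u @ v)"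
proof -
  assume "linv u" "linv v"
  then obtain u' v' where u: "cls (u' @ u) = cls []" and v: "cls (v' @ v) = cls []"
    unfolding linv_def by blast
  have "cls ((v' @ u') @ u @ v) = cls []"
    using cls_insert[OF u, of v' v] v by simp
  then show ?thesis
    unfolding linv_def by blast
qed

lemma iv_append: "iv u \<Longrightarrow> iv v \<Longrightarrow> iv (u @ v)"
  by (simp add: iv_iff_linv_rinv linv_append rinv_append)

lemma iv_Nil [simp]: "iv []"
  unfolding iv_iff by (rule exI[of _ "[]"]) simp

lemma iv_append_left: "iv (u @ v) \<Longrightarrow> iv u \<Longrightarrow> iv v"
proof (rule ivI)
  assume uv: "iv (u @ v)" and u: "iv u"
  show "linv v"
    using uv iv_linv linv_appendD by blast
  from u obtain s where s: "cls (u @ s) = cls []" "cls (s @ u) = cls []"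
    unfolding iv_iff by blast
  from uv obtain t where t: "cls (u @ v @ t) = cls []"
    unfolding iv_iff by auto
  \<comment> \<open>\<open>v @ t\<close> turns out to be the inverse \<open>s\<close> of
    \<open>u\<close>, so \<open>t @ u\<close> is a right inverse of \<open>v\<close>.\<close>
  have "cls (v @ t) = cls (s @ u @ v @ t)"
    using cls_insert[OF s(2), of "[]" "v @ t"] by simp
  also have "\<dots> = cls s"
    using cls_context[OF t, of s "[]"] by simp
  finally have "cls (v @ t @ u) = cls (s @ u)"
    using cls_append[of "v @ t" s u u] by simp
  with s show "rinv v"
    unfolding rinv_def by (intro exI[of _ "t @ u"]) simp
qed

lemma iv_append_right: "iv (u @ v) \<Longrightarrow> iv v \<Longrightarrow> iv u"
proof (rule ivI)
  assume uv: "iv (u @ v)" and v: "iv v"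
  show "rinv u"
    using uv iv_rinv rinv_appendD by blast
  from v obtain s where s: "cls (v @ s) = cls []" "cls (s @ v) = cls []"
    unfolding iv_iff by blast
  from uv obtain t where t: "cls (t @ u @ v) = cls []"
    unfolding iv_iff by auto
  have "cls (t @ u) = cls ((t @ u) @ v @ s)"
    using cls_insert[OF s(1), of "t @ u" "[]"] by simp
  also have "\<dots> = cls s"
    using cls_context[OF t, of "[]" s] by simp
  finally have "cls (v @ t @ u) = cls (v @ s)"
    using cls_append by metis
  with s show "linv u"
    unfolding linv_def by (intro exI[of _ "v @ t"]) simp
qed

text \<open>As a suffix of an invertible word \<open>y\<close> is left invertible, and as a prefix
  of one it is right invertible.\<close>

lemma iv_overlap: "iv (x @ y) \<Longrightarrow> iv (y @ z) \<Longrightarrow> iv y"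
  by (intro ivI) (auto dest: iv_linv iv_rinv linv_appendD rinv_appendD)

text \<open>Used with \<open>s\<close> a suffix of a left invertible word: an invertible word that
  sticks out of it to the right already has an invertible part inside. The next lemma is the mirror
  image.\<close>

lemma iv_prefix_linv: "iv (s @ p) \<Longrightarrow> linv s \<Longrightarrow> iv s"
  by (intro ivI) (auto dest: iv_rinv rinv_appendD)

lemma iv_suffix_rinv: "iv (s @ p) \<Longrightarrow> rinv p \<Longrightarrow> iv p"
  by (intro ivI) (auto dest: iv_linv linv_appendD)

section \<open>Indecomposable factorisations and words over \<Delta>\<close>

lemma indecomposable_prefix:
  "indecomposable_word A ws (p @ q) \<Longrightarrow> iv p \<Longrightarrow> p = [] \<or> q = []"
  unfolding indecomposable_word_def strict_prefix_def by (metis append_Nil2 prefixI same_append_eq)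

lemma indecomposable_iv: "indecomposable_word A ws p \<Longrightarrow> iv p"
  and indecomposable_ne: "indecomposable_word A ws p \<Longrightarrow> p \<noteq> []"
  by (auto simp: indecomposable_word_def)

text \<open>The shortest nonempty invertible prefix is indecomposable, and what follows it is
  invertible by cancellation.\<close>

lemma ex_factorisation: "iv w \<Longrightarrow> \<exists>fs. indecomposable_factorisation A ws w fs"
proof (induction "length w" arbitrary: w rule: less_induct)
  case less
  show ?case
  proof (cases "w = []")
    case True
    then show ?thesis
      by (intro exI[of _ "[]"]) (simp add: indecomposable_factorisation_def)
  next
    case False
    define P where "P n \<longleftrightarrow> 0 < n \<and> n \<le> length w \<and> iv (take n w)" for n
    have "P (length w)"
      using False less.prems by (simp add: P_def)
    then have P: "P (Least P)" and least: "\<And>n. P n \<Longrightarrow> Least P \<le> n"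
      by (auto intro: LeastI Least_le)
    define p where "p = take (Least P) w"
    have p: "p \<noteq> []" "iv p" "length p = Least P"
      using P False by (auto simp: p_def P_def)
    have w: "w = p @ drop (Least P) w"
      by (simp add: p_def)
    have "indecomposable_word A ws p"
      unfolding indecomposable_word_def
    proof (intro conjI allI impI p notI)
      fix q assume q: "q \<noteq> [] \<and> strict_prefix q p" "iv q"
      then obtain t where "p = q @ t" "t \<noteq> []"
        by (auto simp: strict_prefix_def prefix_def)
      with p(3) have "length q < Least P"
        by (cases t) auto
      moreover have "P (length q)"
        using P q \<open>p = q @ t\<close> calculation w unfolding P_def
        by (metis append_assoc append_eq_conv_conj length_greater_0_conv less_le_trans less_imp_le)
      ultimately have "P (length q)" "length q < Least P"
        by auto
      then show False
        using least by fastforce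
    qed
    moreover have "iv (drop (Least P) w)"
      using w less.prems p(2) iv_append_left by metis
    moreover have "length (drop (Least P) w) < length w"
      using P False by (simp add: P_def)
    ultimately obtain fs where "indecomposable_factorisation A ws (drop (Least P) w) fs"
      using less.hyps by blast
    then have "indecomposable_factorisation A ws w (p # fs)"
      using \<open>indecomposable_word A ws p\<close> w by (simp add: indecomposable_factorisation_def)
    then show ?thesis
      by blast
  qed
qed

lemma Delta_indecomposable: "d \<in> Delta A ws \<Longrightarrow> indecomposable_word A ws d"
  by (simp add: Delta_def)

lemma finite_Delta: "finite (Delta A ws)"
proof (rule finite_subset)
  show "Delta A ws \<subseteq> {xs. set xs \<subseteq> A \<and> length xs \<le> Max (length ` set ws)}"
    using iv_lists by (force simp: Delta_def indecomposable_word_def in_lists_conv_set)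
  show "finite {xs. set xs \<subseteq> A \<and> length xs \<le> Max (length ` set ws)}"
    using finite_A by (rule finite_lists_length_le)
qed

lemma D_induct [consumes 1, case_names Nil append]:
  assumes "w \<in> D" "P []"
    and "\<And>d w. d \<in> Delta A ws \<Longrightarrow> w \<in> D \<Longrightarrow> P w \<Longrightarrow> P (d @ w)"
  shows "P w"
proof -
  have "fs \<in> lists (Delta A ws) \<Longrightarrow> P (concat fs)" for fs
    by (induction fs) (auto simp: D_def intro!: assms(2,3))
  then show ?thesis
    using assms(1) unfolding D_def by blast
qed

lemma D_Nil: "[] \<in> D"
  unfolding D_def by (rule image_eqI[of _ _ "[]"]) simp_all

lemma D_append:
  assumes "u \<in> D" "v \<in> D" shows "u @ v \<in> D"
proof -
  from assms(1) obtain fs where "u = concat fs" "fs \<in> lists (Delta A ws)"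
    unfolding D_def by (rule imageE)
  moreover from assms(2) obtain gs where "v = concat gs" "gs \<in> lists (Delta A ws)"
    unfolding D_def by (rule imageE)
  ultimately show ?thesis
    unfolding D_def by (intro image_eqI[of _ _ "fs @ gs"]) simp_all
qed

lemma Delta_D: "d \<in> Delta A ws \<Longrightarrow> d \<in> D"
  unfolding D_def by (rule image_eqI[of _ _ "[d]"]) simp_all

lemma D_iv: "w \<in> D \<Longrightarrow> iv w"
  by (induction rule: D_induct) (auto intro: iv_append indecomposable_iv Delta_indecomposable)

text \<open>An invertible prefix ends at a boundary between factors: once whole factors are
  cancelled from it, an end inside the next factor would contradict indecomposability.\<close>

lemma D_split: "u @ v \<in> D \<Longrightarrow> iv u \<Longrightarrow> u \<in> D \<and> v \<in> D"
proof (induction "u @ v" arbitrary: u v rule: D_induct)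
  case Nil
  then show ?case
    using D_Nil by simp
next
  case (append d w)
  from append(4) consider t where "d = u @ t" "v = t @ w" | t where "u = d @ t" "w = t @ v"
    by (rule append_eq_appendE)
  then show ?case
  proof cases
    case 1
    with append have "u = [] \<or> t = []"
      by (auto dest: indecomposable_prefix Delta_indecomposable)
    moreover have "d @ w \<in> D" "d \<in> D" "w \<in> D"
      using append(1,2) by (simp_all add: Delta_D D_append)
    ultimately show ?thesis
      using 1 D_Nil by auto
  next
    case 2
    then have "iv t"
      using append iv_append_left indecomposable_iv Delta_indecomposable by metis
    then have "t \<in> D \<and> v \<in> D"
      using 2 append by simp
    then show ?thesis
      using 2 append by (auto intro: Delta_D D_append)
  qed
qed

lemma D_relator:
  assumes "w \<in> set ws"
  shows "w \<in> D"
proof -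
  have "w \<in> lists A"
    using assms ws_A by auto
  then have w: "cls w = cls []"
    unfolding special_class_def using assms
    by (subst word_class_eq_iff) (auto intro: word_cong.base simp: special_rels_def)
  then have "iv w"
    using iv_cong by auto
  then obtain fs where fs: "indecomposable_factorisation A ws w fs"
    using ex_factorisation by blast
  have "f \<in> Delta A ws" if f: "f \<in> set fs" for f
  proof -
    obtain as bs where "fs = as @ f # bs"
      using f by (auto simp: in_set_conv_decomp)
    then have "length f \<le> length w"
      using fs by (auto simp: indecomposable_factorisation_def)
    also have "\<dots> \<le> Max (length ` set ws)"
      using assms by simp
    finally show ?thesis
      using fs that assms by (auto simp: Delta_def indecomposable_factorisation_def)
  qed
  then show ?thesis
    using fs unfolding indecomposable_factorisation_def D_def
    by (intro image_eqI[of _ _ fs]) (auto simp: in_lists_conv_set)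
qed

section \<open>Zhang's rewriting system\<close>

abbreviation "rule u v \<equiv> (u, v) \<in> special_rewrites A ws r"

inductive step :: "'a list \<Rightarrow> 'a list \<Rightarrow> bool" where
  rewrite: "rule u v \<Longrightarrow> x \<in> lists A \<Longrightarrow> y \<in> lists A \<Longrightarrow> step (x @ u @ y) (x @ v @ y)"

lemma ruleD:
  assumes "rule u v"
  shows "u \<in> D" "v \<in> D" "cls u = cls v" "length v \<le> length u" "u \<noteq> []" "(v, u) \<in> lenlex r"
  using assms by (auto simp: special_rewrites_def D_def dest: lenlex_length)

lemma step_cls: "step u v \<Longrightarrow> cls u = cls v"
  by (induction rule: step.induct) (auto dest: ruleD intro!: cls_context)

lemma steps_cls: "step\<^sup>*\<^sup>* u v \<Longrightarrow> cls u = cls v"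
  by (induction rule: rtranclp_induct) (auto dest: step_cls)

text \<open>The relation \<open>r\<close> is only known to be a linear order on \<open>A\<close>, not to be contained in
  \<open>A \<times> A\<close>, hence the restriction.\<close>

lemma wf_lenlex_A: "wf (lenlex (r \<inter> A \<times> A))"
proof (rule wf_lenlex)
  have "finite (r \<inter> A \<times> A)"
    using finite_A by blast
  moreover have "acyclic (r \<inter> A \<times> A)"
  proof (rule acyclicI)
    have "trans (r \<inter> A \<times> A)" "irrefl r"
      using order_r unfolding strict_linear_order_on_def trans_def by blast+
    then show "\<forall>x. (x, x) \<notin> (r \<inter> A \<times> A)\<^sup>+"
      by (auto simp: irrefl_def)
  qed
  ultimately show "wf (r \<inter> A \<times> A)"
    by (rule finite_acyclic_wf)
qed

lemma lenlex_restrict: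
  assumes "u \<in> lists A" "v \<in> lists A" "(u, v) \<in> lenlex r"
  shows "(u, v) \<in> lenlex (r \<inter> A \<times> A)"
  using assms by (auto simp: lenlex_conv lex_conv)

lemma step_lenlex: "step u v \<Longrightarrow> (v, u) \<in> lenlex (r \<inter> A \<times> A)"
proof (induction rule: step.induct)
  case (rewrite u v x y)
  note * = ruleD[OF rewrite(1)]
  have "(v @ y, u @ y) \<in> lenlex (r \<inter> A \<times> A)"
    using * by (intro lenlex_append1 lenlex_restrict iv_lists D_iv) auto
  moreover have "irrefl (r \<inter> A \<times> A)"
    using order_r by (auto simp: strict_linear_order_on_def irrefl_def)
  ultimately show ?case
    by simp
qed

lemma wf_step: "wf {(v, u). step u v}"
  by (rule wf_subset[OF wf_lenlex_A]) (auto dest: step_lenlex)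

text \<open>This is what makes critical pairs easy: equal words over \<Delta> are at most one rule
  apart.\<close>

lemma D_rule_total:
  assumes "u \<in> D" "v \<in> D" "cls u = cls v"
  shows "u = v \<or> rule u v \<or> rule v u"
proof -
  have "u \<noteq> v \<Longrightarrow> (u, v) \<in> lenlex r \<or> (v, u) \<in> lenlex r"
  proof -
    have "total_on A r"
      using order_r by (simp add: strict_linear_order_on_def)
    have "length u = length v \<Longrightarrow> u \<noteq> v \<Longrightarrow> u \<in> lists A \<Longrightarrow> v \<in> lists A \<Longrightarrow>
        (u, v) \<in> lenlex r \<or> (v, u) \<in> lenlex r"
    proof (induction u v rule: list_induct2)
      case (Cons x xs y ys)
      then show ?case
        using \<open>total_on A r\<close> by (auto simp: Cons_lenlex_iff total_on_def)
    qed simp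
    then show "u \<noteq> v \<Longrightarrow> (u, v) \<in> lenlex r \<or> (v, u) \<in> lenlex r"
      using assms(1,2) D_iv iv_lists by (cases "length u" "length v" rule: linorder_cases) (auto simp: lenlex_conv)
  qed
  then show ?thesis
    using assms by (auto simp: special_rewrites_def D_def)
qed

text \<open>Class and length bound are preserved, so indecomposability is the point. An invertible
  prefix of \<open>x @ v @ z\<close> that ends inside \<open>x\<close> or inside \<open>z\<close>
  yields one of \<open>x @ u @ z\<close>. If it ends inside \<open>v\<close>, its part in
  \<open>v\<close> is a suffix of an invertible word and a prefix of \<open>v\<close>, hence
  invertible, and then \<open>x\<close> is an invertible proper prefix of the original word.
  Rewriting the whole word is excluded by \<open>ne\<close>, since then \<open>v\<close> is only
  known to lie in \<open>D\<close>.\<close>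

lemma Delta_rule:
  assumes d: "x @ u @ z \<in> Delta A ws" and rule: "rule u v" and ne: "x \<noteq> [] \<or> z \<noteq> []"
  shows "x @ v @ z \<in> Delta A ws"
proof -
  note r = ruleD[OF rule]
  have ind: "indecomposable_word A ws (x @ u @ z)"
    using d by (rule Delta_indecomposable)
  have iv: "iv u" "iv v"
    using r D_iv by auto
  have cls: "cls (x @ u @ z) = cls (x @ v @ z)"
    using r by (intro cls_context)
  have x: "x \<noteq> []"
  proof
    assume "x = []"
    then show False
      using ind ne iv r indecomposable_prefix[of u z] by auto
  qed
  have "indecomposable_word A ws (x @ v @ z)"
    unfolding indecomposable_word_def
  proof (intro conjI allI impI notI)
    show "x @ v @ z = [] \<Longrightarrow> False"
      using x by simp
    show "iv (x @ v @ z)"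
      using cls ind iv_cong indecomposable_iv by blast
    fix p assume p: "p \<noteq> [] \<and> strict_prefix p (x @ v @ z)" "iv p"
    then obtain t where t: "x @ v @ z = p @ t" "t \<noteq> []"
      by (auto simp: strict_prefix_def prefix_def)
    from t(1) consider s where "x = p @ s" "t = s @ v @ z" | s where "p = x @ s" "v @ z = s @ t"
      by (rule append_eq_appendE)
    then show False
    proof cases
      case 1
      then show ?thesis
        using ind p r indecomposable_prefix[of p "s @ u @ z"] by simp
    next
      case 2
      from 2(2) consider q where "v = s @ q" "t = q @ z" | q where "s = v @ q" "z = q @ t"
        by (rule append_eq_appendE)
      then show ?thesis
      proof cases
        case 1
        have "linv s"
          using p(2) 2 by (auto dest: iv_linv linv_appendD)
        then have "iv s"
          using 1 iv iv_prefix_linv by blast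
        then have "iv x"
          using p(2) 2 iv_append_right by blast
        then show ?thesis
          using ind x r indecomposable_prefix[of x "u @ z"] by simp
      next
        case q: 2
        have "cls (x @ u @ q) = cls p"
          using 2 q r cls_context[of u v x q] by simp
        then have "iv (x @ u @ q)"
          using p iv_cong by blast
        then show ?thesis
          using ind q x t indecomposable_prefix[of "x @ u @ q" t] by simp
      qed
    qed
  qed
  moreover have "length (x @ v @ z) \<le> Max (length ` set ws)"
    using d r by (simp add: Delta_def)
  ultimately show ?thesis
    using d cls by (simp add: Delta_def)
qed

text \<open>The delicate case is a left-hand side that starts in the first factor \<open>d\<close>
  and leaves it. The overlap is invertible by \<open>iv_overlap\<close>, so \<open>u\<close> must
  start at the beginning of \<open>d\<close>, and \<open>D_split\<close> shows that it also ends at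
  a boundary.\<close>

lemma D_rule: "w \<in> D \<Longrightarrow> w = x @ u @ z \<Longrightarrow> rule u v \<Longrightarrow> x @ v @ z \<in> D"
proof (induction arbitrary: x z rule: D_induct)
  case Nil
  then show ?case
    by (auto dest: ruleD)
next
  case (append d w)
  note r = ruleD[OF append(5)]
  have ind: "indecomposable_word A ws d"
    using append(1) by (rule Delta_indecomposable)
  from append(4) consider t where "d = x @ t" "u @ z = t @ w" | t where "x = d @ t" "w = t @ u @ z"
    by (rule append_eq_appendE)
  then show ?case
  proof cases
    case 2
    then have "t @ v @ z \<in> D"
      using append by blast
    then show ?thesis
      using 2 append D_append[OF Delta_D] by simp
  next
    case 1
    from 1(2) consider y where "u = t @ y" "w = y @ z" | y where "t = u @ y" "z = y @ w"
      by (rule append_eq_appendE)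
    then show ?thesis
    proof cases
      case y: 2
      show ?thesis
      proof (cases "x = [] \<and> y = []")
        case True
        then show ?thesis
          using y D_append[OF r(2) append(2)] by simp
      next
        case False
        then have "x @ v @ y \<in> Delta A ws"
          using append(1) 1(1) y(1) by (intro Delta_rule[OF _ append(5)]) auto
        then show ?thesis
          using y(2) D_append[OF Delta_D append(2)] by fastforce
      qed
    next
      case y: 1
      show ?thesis
      proof (cases "t = []")
        case True
        then have xw: "x = d" "w = u @ z"
          using 1 y by auto
        have "z \<in> D"
          using D_split[of u z] append(2) xw D_iv[OF r(1)] by simp
        then show ?thesis
          using xw D_append[OF Delta_D[OF append(1)] D_append[OF r(2)]] by simp
      next
        case False
        have "iv t"
          using iv_overlap[of x t y] indecomposable_iv[OF ind] D_iv[OF r(1)] 1(1) y(1) by simp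
        then have "iv x"
          using ind 1 iv_append_right indecomposable_iv by blast
        then have "x = []"
          using ind 1 False indecomposable_prefix by blast
        have "iv y"
          using iv_append_left[of t y] \<open>iv t\<close> D_iv[OF r(1)] y(1) by simp
        then have "z \<in> D"
          using D_split[of y z] append(2) y(2) by simp
        then show ?thesis
          using \<open>x = []\<close> r D_append by simp
      qed
    qed
  qed
qed

section \<open>Confluence\<close>

definition joinable :: "'a list \<Rightarrow> 'a list \<Rightarrow> bool" where
  "joinable u v \<longleftrightarrow> (\<exists>w. step\<^sup>*\<^sup>* u w \<and> step\<^sup>*\<^sup>* v w)"

lemma joinable_sym: "joinable u v \<Longrightarrow> joinable v u"
  unfolding joinable_def by blast

lemma joinable_D:
  assumes "u \<in> D" "v \<in> D" "cls u = cls v" "x \<in> lists A" "y \<in> lists A"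
  shows "joinable (x @ u @ y) (x @ v @ y)"
  using D_rule_total[OF assms(1-3)] rewrite assms(4,5) unfolding joinable_def by blast

text \<open>By symmetry the first left-hand side starts no later than the second. Disjoint left-hand
  sides commute; in the other cases the two results differ in one factor, which on both sides is a
  word over \<Delta> of the same class.\<close>

lemma joinable_left:
  assumes "rule u v" "rule u' v'" "x @ u @ y = x' @ u' @ y'" "length x \<le> length x'"
    and A: "x \<in> lists A" "y \<in> lists A" "x' \<in> lists A" "y' \<in> lists A"
  shows "joinable (x @ v @ y) (x' @ v' @ y')"
proof -
  note r = ruleD[OF assms(1)] and r' = ruleD[OF assms(2)]
  from assms(3,4) obtain t where t: "x' = x @ t" "u @ y = t @ u' @ y'"
    by (elim append_eq_appendE) auto
  from t(2) obtain m where "u = t @ m \<and> m @ y = u' @ y' \<or> t = u @ m \<and> y = m @ u' @ y'"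
    by (rule append_eq_appendE) auto
  then consider "t = u @ m" "y = m @ u' @ y'" | "u = t @ m" "m \<noteq> []" "m @ y = u' @ y'"
    by (cases "m = []") auto
  then show ?thesis
  proof cases
    case 1
    have "step ((x @ v @ m) @ u' @ y') ((x @ v @ m) @ v' @ y')"
      using 1 t A r D_iv[THEN iv_lists] by (intro rewrite assms(2)) auto
    moreover have "step (x @ u @ (m @ v' @ y')) (x @ v @ (m @ v' @ y'))"
      using 1 t A r' D_iv[THEN iv_lists] by (intro rewrite assms(1)) auto
    ultimately show ?thesis
      using 1 t unfolding joinable_def by (intro exI[of _ "x @ v @ m @ v' @ y'"]) auto
  next
    case 2
    from 2(3) consider n where "m = u' @ n" "y' = n @ y" | n where "u' = m @ n" "y = n @ y'"
      by (rule append_eq_appendE)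
    then show ?thesis
    proof cases
      case n: 1
      \<comment> \<open>The second left-hand side lies inside the first; \<open>D_rule\<close> keeps
        the partly rewritten word over \<Delta>, hence comparable with \<open>v\<close>.\<close>
      have "t @ v' @ n \<in> D" "cls v = cls (t @ v' @ n)"
        using D_rule[of u t u' n v'] 2 n r r' assms(2) cls_context[of u' v' t n] by auto
      then show ?thesis
        using joinable_D[of v "t @ v' @ n" x y] r A t n by simp
    next
      case n: 2
      \<comment> \<open>A proper overlap: \<open>m\<close> is invertible, so \<open>t\<close>,
        \<open>m\<close> and \<open>n\<close> are all words over \<Delta>.\<close>
      have "iv m"
        using iv_overlap[of t m n] 2 n r r' D_iv by metis
      then have "iv t"
        using iv_append_right[of t m] 2 r D_iv by metis
      have "t \<in> D" "m \<in> D" "n \<in> D"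
        using D_split[of t m] D_split[of m n] \<open>iv t\<close> \<open>iv m\<close> 2 n r r' by auto
      have "cls (v @ n) = cls (t @ v')"
        using cls_append[of u v n n] cls_append[of t t u' v'] 2 n r r' by simp
      then show ?thesis
        using joinable_D[of "v @ n" "t @ v'" x y'] \<open>t \<in> D\<close> \<open>n \<in> D\<close> r r' A n t by (simp add: D_append)
    qed
  qed
qed

lemma local_confluence: "step w u \<Longrightarrow> step w v \<Longrightarrow> joinable u v"
proof -
  assume "step w u" and "step w v"
  from \<open>step w u\<close> obtain x l l' y where l: "rule l l'" "w = x @ l @ y" "x \<in> lists A" "y \<in> lists A" "u = x @ l' @ y"
    by (auto elim!: step.cases)
  from \<open>step w v\<close> obtain x' k k' y' where k: "rule k k'" "w = x' @ k @ y'" "x' \<in> lists A" "y' \<in> lists A"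
      "v = x' @ k' @ y'"
    by (auto elim!: step.cases)
  note * = l k
  show ?thesis
  proof (cases "length x \<le> length x'")
    case True
    then show ?thesis
      using * joinable_left[of l l' k k' x y x' y'] by simp
  next
    case False
    then show ?thesis
      using * joinable_left[of k k' l l' x' y' x y] by (auto intro: joinable_sym)
  qed
qed

text \<open>Newman's lemma, by well-founded induction along \<open>wf_step\<close>.\<close>

lemma confluence: "step\<^sup>*\<^sup>* w u \<Longrightarrow> step\<^sup>*\<^sup>* w v \<Longrightarrow> joinable u v"
proof (induction w arbitrary: u v rule: wf_induct_rule[OF wf_step])
  case (1 w)
  show ?case
  proof (cases "w = u \<or> w = v")
    case True
    then show ?thesis
      using 1 by (auto simp: joinable_def)
  next
    case False
    then obtain u1 v1 where u1: "step w u1" "step\<^sup>*\<^sup>* u1 u" and v1: "step w v1" "step\<^sup>*\<^sup>* v1 v"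
      using 1(2,3) by (metis converse_rtranclpE)
    then obtain z where z: "step\<^sup>*\<^sup>* u1 z" "step\<^sup>*\<^sup>* v1 z"
      using local_confluence unfolding joinable_def by blast
    obtain s where s: "step\<^sup>*\<^sup>* u s" "step\<^sup>*\<^sup>* z s"
      using 1(1)[OF _ u1(2) z(1)] u1(1) unfolding joinable_def by blast
    obtain q where "step\<^sup>*\<^sup>* v q" "step\<^sup>*\<^sup>* s q"
      using 1(1)[OF _ v1(2) rtranclp_trans[OF z(2) s(2)]] v1(1) unfolding joinable_def by blast
    then show ?thesis
      using s unfolding joinable_def by (meson rtranclp_trans)
  qed
qed

lemma joinable_trans:
  assumes "joinable u v" "joinable v w"
  shows "joinable u w"
proof -
  obtain s t where "step\<^sup>*\<^sup>* u s" "step\<^sup>*\<^sup>* v s" "step\<^sup>*\<^sup>* v t" "step\<^sup>*\<^sup>* w t"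
    using assms unfolding joinable_def by blast
  moreover obtain q where "step\<^sup>*\<^sup>* s q" "step\<^sup>*\<^sup>* t q"
    using calculation confluence unfolding joinable_def by blast
  ultimately show ?thesis
    unfolding joinable_def by (meson rtranclp_trans)
qed

lemma steps_context:
  "step\<^sup>*\<^sup>* u v \<Longrightarrow> x \<in> lists A \<Longrightarrow> y \<in> lists A \<Longrightarrow> step\<^sup>*\<^sup>* (x @ u @ y) (x @ v @ y)"
proof (induction rule: rtranclp_induct)
  case (step v w)
  from step(2) have "step (x @ v @ y) (x @ w @ y)"
  proof cases
    case (rewrite l k a b)
    then show ?thesis
      using step.rewrite[of l k "x @ a" "b @ y"] step by simp
  qed
  then show ?case
    using step by (meson rtranclp.rtrancl_into_rtrancl)
qed simp

lemma word_cong_joinable: "(u, v) \<in> word_cong A (special_rels ws) \<Longrightarrow> joinable u v"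
proof (induction rule: word_cong.induct)
  case (base u v)
  \<comment> \<open>A relator is a word over \<Delta> that equals 1, so it is empty or the left-hand
    side of a rule.\<close>
  then have "u \<in> D" "v = []" "cls u = cls []"
    using D_relator by (auto simp: special_rels_def special_class_def word_class_eq_iff intro: word_cong.base)
  then show ?case
    using joinable_D[of u "[]" "[]" "[]"] D_Nil by simp
next
  case (refl u)
  show ?case
    unfolding joinable_def by blast
next
  case (sym u v)
  then show ?case
    by (simp add: joinable_sym)
next
  case (trans u v w)
  then show ?case
    using joinable_trans by blast
next
  case (mult u u' v v')
  note A = mult(1,2)[THEN word_cong_in_lists]
  obtain s t where s: "step\<^sup>*\<^sup>* u s" "step\<^sup>*\<^sup>* u' s" and t: "step\<^sup>*\<^sup>* v t" "step\<^sup>*\<^sup>* v' t"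
    using mult unfolding joinable_def by blast
  have "s \<in> lists A"
    using cls_lists[OF steps_cls[OF s(1)]] A by simp
  have "step\<^sup>*\<^sup>* (u @ v) (s @ t)"
    using steps_context[OF s(1), of "[]" v] steps_context[OF t(1), of s "[]"] \<open>s \<in> lists A\<close> A
    by simp
  moreover have "step\<^sup>*\<^sup>* (u' @ v') (s @ t)"
    using steps_context[OF s(2), of "[]" v'] steps_context[OF t(2), of s "[]"] \<open>s \<in> lists A\<close> A
    by simp
  ultimately show ?case
    unfolding joinable_def by blast
qed

section \<open>Reduced words as unique representatives\<close>

lemma reduced_iff: "red w \<longleftrightarrow> w \<in> lists A \<and> (\<nexists>v. step w v)"
proof
  assume "red w"
  then show "w \<in> lists A \<and> (\<nexists>v. step w v)"
    unfolding reduced_word_def sublist_def by (auto elim!: step.cases)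
next
  assume w: "w \<in> lists A \<and> (\<nexists>v. step w v)"
  show "red w"
    unfolding reduced_word_def
  proof (intro conjI notI)
    assume "\<exists>(u, v)\<in>special_rewrites A ws r. sublist u w"
    then obtain u v x y where "rule u v" "w = x @ u @ y"
      by (auto simp: sublist_def)
    then show False
      using w rewrite[of u v x y] by auto
  qed (use w in simp)
qed

lemma reduced_unique:
  assumes "red u" "red v" "cls u = cls v"
  shows "u = v"
proof -
  have "(u, v) \<in> word_cong A (special_rels ws)"
    using assms by (simp add: special_class_def word_class_eq_iff reduced_iff)
  then obtain w where "step\<^sup>*\<^sup>* u w" "step\<^sup>*\<^sup>* v w"
    using word_cong_joinable unfolding joinable_def by blast
  then show ?thesis
    using assms unfolding reduced_iff by (metis converse_rtranclpE)
qed

lemma ex_reduced: "w \<in> lists A \<Longrightarrow> \<exists>u. red u \<and> cls u = cls w"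
proof (induction w rule: wf_induct_rule[OF wf_step])
  case (1 w)
  show ?case
  proof (cases "red w")
    case False
    then obtain v where "step w v"
      using 1 reduced_iff by blast
    then show ?thesis
      using 1(1)[of v] 1(2) cls_lists[OF step_cls] by (auto simp: step_cls)
  qed blast
qed

lemma reduced_lists: "red w \<Longrightarrow> w \<in> lists A"
  by (simp add: reduced_word_def)

lemma reduced_appendD1: "red (u @ v) \<Longrightarrow> red u" and reduced_appendD2: "red (u @ v) \<Longrightarrow> red v"
  unfolding reduced_word_def by (auto simp: sublist_append)

lemma reduced_Nil [simp]: "red []"
  by (auto simp: reduced_word_def dest: ruleD)

lemma not_reduced_appendD:
  assumes "red u" "red v" "\<not> red (u @ v)"
  obtains x s p y where "u = x @ s" "v = p @ y" "s \<noteq> []" "p \<noteq> []" "s @ p \<in> D"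
proof -
  have "u @ v \<in> lists A"
    using assms by (auto dest: reduced_lists)
  then obtain l k where lk: "rule l k" "sublist l (u @ v)"
    using assms(3) unfolding reduced_word_def by blast
  moreover have "\<not> sublist l u" "\<not> sublist l v"
    using assms lk unfolding reduced_word_def by auto
  ultimately obtain s p where "l = s @ p" "suffix s u" "prefix p v"
    unfolding sublist_append by blast
  moreover have "s \<noteq> []" "p \<noteq> []"
    using calculation \<open>\<not> sublist l u\<close> \<open>\<not> sublist l v\<close> by auto
  ultimately show thesis
    using that lk ruleD(1)[OF lk(1)] by (auto simp: suffix_def prefix_def)
qed

text \<open>A reduced product \<open>w w' = 1\<close> must contain a rule across the boundary; the part of the
  left-hand side inside \<open>w\<close> is then itself invertible and splits off.\<close>

lemma reduced_iv_D: "red w \<Longrightarrow> iv w \<Longrightarrow> w \<in> D"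
proof (induction "length w" arbitrary: w rule: less_induct)
  case less
  show ?case
  proof (cases "w = []")
    case True
    then show ?thesis
      by (simp add: D_Nil)
  next
    case False
    obtain v0 where v0: "cls (w @ v0) = cls []" "cls (v0 @ w) = cls []"
      using less.prems by (auto simp: iv_iff)
    then have "v0 \<in> lists A"
      by (auto dest: cls_Nil_lists)
    then obtain v where v: "red v" "cls v = cls v0"
      using ex_reduced by blast
    have wv: "cls (w @ v) = cls []"
      using v v0 cls_append[of w w v v0] by simp
    have vw: "cls (v @ w) = cls []"
      using v v0 cls_append[of v v0 w w] by simp
    have "\<not> red (w @ v)"
      using reduced_unique[of "w @ v" "[]"] wv False by auto
    then obtain x s p y where *: "w = x @ s" "v = p @ y" "s \<noteq> []" "p \<noteq> []" "s @ p \<in> D"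
      using not_reduced_appendD less.prems v by metis
    have "linv s"
      using less.prems * by (auto dest: iv_linv linv_appendD)
    then have "iv s"
      using * D_iv iv_prefix_linv by blast
    then have "s \<in> D"
      using * D_split by blast
    moreover have "iv x"
      using less.prems * \<open>iv s\<close> iv_append_right by blast
    then have "x \<in> D"
      using less * reduced_appendD1 by simp
    ultimately show ?thesis
      using * D_append by simp
  qed
qed

end

section \<open>Cuts of height zero\<close>

lemma finite_cutting_occurrences: "finite (cutting_occurrences A ws u v)"
proof (rule finite_subset)
  show "cutting_occurrences A ws u v \<subseteq> set (suffixes u) \<times> set (prefixes v)"
    by (auto simp: cutting_occurrences_def)
qed simp

text \<open>If the whole word \<open>u @ v\<close> is invertible, it is the largest occurrence, and
  any other one would form a two-element chain with it. Finiteness of the set of chain lengths is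
  needed to compare with its \<open>Max\<close>.\<close>

lemma height_zero_unique:
  assumes "height A ws u v = 0" "(u, v) \<in> cutting_occurrences A ws u v"
    and "(s, p) \<in> cutting_occurrences A ws u v"
  shows "s = u \<and> p = v"
proof (rule ccontr)
  assume ne: "\<not> (s = u \<and> p = v)"
  let ?C = "{card K - 1 | K. K \<noteq> {} \<and> K \<subseteq> cutting_occurrences A ws u v \<and> K \<in> Chains occurrence_inclusion}"
  let ?K = "{(s, p), (u, v)}"
  have "?K \<in> Chains occurrence_inclusion"
    using assms(3) by (auto simp: Chains_def occurrence_inclusion_def cutting_occurrences_def)
  then have "card ?K - 1 \<in> ?C"
    using assms by blast
  moreover have "?C \<subseteq> (\<lambda>K. card K - 1) ` Pow (cutting_occurrences A ws u v)"
    by blast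
  then have "finite ?C"
    by (rule finite_subset) (simp add: finite_cutting_occurrences)
  ultimately have "card ?K - 1 \<le> height A ws u v"
    unfolding height_def by (intro Max_ge)
  then show False
    using assms(1) ne by auto
qed

lemma height_singleton:
  assumes "cutting_occurrences A ws u v = {c}"
  shows "height A ws u v = 0"
proof -
  have "{c} \<in> Chains occurrence_inclusion"
    by (cases c) (simp add: Chains_def occurrence_inclusion_def)
  then have "{card K - 1 | K. K \<noteq> {} \<and> K \<subseteq> {c} \<and> K \<in> Chains occurrence_inclusion} = {0}"
    by (auto simp: subset_singleton_iff intro!: exI[of _ "{c}"])
  then show ?thesis
    unfolding height_def assms by simp
qed

lemma inverse_pairs_simps [simp]:
  "(u, v) \<in> carrier (inverse_pairs M) \<longleftrightarrow> u \<in> carrier M \<and> v \<in> carrier M \<and> u \<otimes>\<^bsub>M\<^esub> v = \<one>\<^bsub>M\<^esub>"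
  "(a, b) \<otimes>\<^bsub>inverse_pairs M\<^esub> (x, y) = (a \<otimes>\<^bsub>M\<^esub> x, y \<otimes>\<^bsub>M\<^esub> b)"
  "\<one>\<^bsub>inverse_pairs M\<^esub> = (\<one>\<^bsub>M\<^esub>, \<one>\<^bsub>M\<^esub>)"
  by (simp_all add: inverse_pairs_def)

lemma monoid_inverse_pairs:
  assumes "monoid M"
  shows "monoid (inverse_pairs M)"
proof -
  interpret monoid M by fact
  have "a \<otimes>\<^bsub>M\<^esub> x \<otimes>\<^bsub>M\<^esub> (y \<otimes>\<^bsub>M\<^esub> b) = \<one>\<^bsub>M\<^esub>"
    if "a \<in> carrier M" "b \<in> carrier M" "x \<in> carrier M" "y \<in> carrier M"
      "a \<otimes>\<^bsub>M\<^esub> b = \<one>\<^bsub>M\<^esub>" "x \<otimes>\<^bsub>M\<^esub> y = \<one>\<^bsub>M\<^esub>" for a b x y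
    using that by (metis m_assoc m_closed r_one)
  then show ?thesis
    by (intro monoidI) (auto simp: m_assoc)
qed

context special_presentation
begin

section \<open>Invertible factors near a height zero cut\<close>

definition height_zero_cut :: "'a list \<Rightarrow> 'a list \<Rightarrow> bool" where
  "height_zero_cut d1 d2 \<longleftrightarrow> d1 \<noteq> [] \<and> d2 \<noteq> [] \<and> red d1 \<and> red d2 \<and> iv (d1 @ d2) \<and>
     height A ws d1 d2 = 0 \<and> no_invertible_suffix A ws d1"

definition no_iv_prefix :: "'a list \<Rightarrow> bool" where
  "no_iv_prefix u \<longleftrightarrow> (\<forall>p t. u = p @ t \<longrightarrow> iv p \<longrightarrow> p = [])"

abbreviation "no_iv_suffix \<equiv> no_invertible_suffix A ws"

lemma no_iv_prefixD: "no_iv_prefix (p @ t) \<Longrightarrow> iv p \<Longrightarrow> p = []"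
  unfolding no_iv_prefix_def by blast

lemma no_iv_suffixD: "no_iv_suffix (t @ s) \<Longrightarrow> iv s \<Longrightarrow> s = []"
  by (auto simp: no_invertible_suffix_def suffix_def)

lemma no_iv_suffixI: "(\<And>t s. w = t @ s \<Longrightarrow> iv s \<Longrightarrow> s = []) \<Longrightarrow> no_iv_suffix w"
  by (auto simp: no_invertible_suffix_def suffix_def)

lemma cutD:
  assumes "height_zero_cut d1 d2"
  shows "d1 \<noteq> []" "d2 \<noteq> []" "red d1" "red d2" "iv (d1 @ d2)" "rinv d1" "linv d2"
  using assms iv_linv[of "d1 @ d2"] iv_rinv[of "d1 @ d2"]
  by (auto simp: height_zero_cut_def dest: linv_appendD rinv_appendD)

lemma cut_crossing:
  assumes "height_zero_cut (a @ s) (p @ b)" "s \<noteq> []" "p \<noteq> []" "iv (s @ p)"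
  shows "a = [] \<and> b = []"
proof -
  have "(s, p) \<in> cutting_occurrences A ws (a @ s) (p @ b)"
    "(a @ s, p @ b) \<in> cutting_occurrences A ws (a @ s) (p @ b)"
    using assms cutD[OF assms(1)] by (auto simp: cutting_occurrences_def suffix_def)
  then show ?thesis
    using height_zero_unique[of A ws "a @ s" "p @ b" s p] assms(1) by (simp add: height_zero_cut_def)
qed

lemma cut_left_suffix: "height_zero_cut (a @ s) d2 \<Longrightarrow> iv s \<Longrightarrow> s = []"
  unfolding height_zero_cut_def by (blast dest: no_iv_suffixD)

lemma cut_left_not_iv: "height_zero_cut d1 d2 \<Longrightarrow> \<not> iv d1"
  using cut_left_suffix[of "[]" d1 d2] cutD(1) by auto

text \<open>Cancelling \<open>p\<close> from the invertible word \<open>p @ b @ d2\<close> leaves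
  the invertible word \<open>b @ d2\<close>, which also crosses the cut and so must be
  everything.\<close>

lemma cut_left_prefix:
  assumes "height_zero_cut (p @ b) d2" "iv p"
  shows "p = []"
proof (cases "b = []")
  case True
  then show ?thesis
    using assms cut_left_not_iv by auto
next
  case False
  have "iv (b @ d2)"
    using iv_append_left[of p "b @ d2"] assms cutD(5)[OF assms(1)] by simp
  then show ?thesis
    using cut_crossing[of p b d2 "[]"] assms(1) False cutD(2)[OF assms(1)] by simp
qed

text \<open>Dual cancellation. With condition (4) this leaves only prefixes of the right-hand part
  as possible invertible factors at an end of one of the two parts.\<close>

lemma cut_right_suffix:
  assumes "height_zero_cut d1 (a @ s)" "iv s"
  shows "s = []"
proof -
  have "iv (d1 @ a)"
    using iv_append_right[of "d1 @ a" s] assms cutD(5)[OF assms(1)] by simp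
  then have "a \<noteq> []"
    using assms(1) cut_left_not_iv by auto
  then show ?thesis
    using cut_crossing[of "[]" d1 a s] assms(1) \<open>iv (d1 @ a)\<close> cutD(1)[OF assms(1)] by simp
qed

section \<open>Reduced products with cuts and units\<close>

lemma reduced_appendI:
  assumes "red u" "red v"
    and "\<And>a s p b. \<lbrakk>u = a @ s; v = p @ b; s \<noteq> []; p \<noteq> []; iv (s @ p)\<rbrakk> \<Longrightarrow> False"
  shows "red (u @ v)"
proof (rule ccontr)
  assume "\<not> red (u @ v)"
  then obtain x s p y where *: "u = x @ s" "v = p @ y" "s \<noteq> []" "p \<noteq> []" "s @ p \<in> D"
    using not_reduced_appendD[OF assms(1,2)] by blast
  then show False
    using assms(3)[of x s p y] D_iv by blast
qed

text \<open>In an invertible word \<open>s @ p\<close> across the boundary \<open>p\<close> is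
  invertible, because \<open>u\<close> is right invertible; then \<open>s\<close> is an invertible
  suffix of \<open>d1\<close>, against condition (4).\<close>

lemma cut_append_reduced:
  assumes "height_zero_cut d1 d2" "red u" "rinv u"
  shows "red (d1 @ u)"
proof (rule reduced_appendI)
  fix a s p b
  assume *: "d1 = a @ s" "u = p @ b" "s \<noteq> []" "p \<noteq> []" "iv (s @ p)"
  then have "iv p"
    using assms(3) iv_suffix_rinv rinv_appendD by blast
  then have "iv s"
    using * iv_append_right by blast
  then show False
    using assms(1) * cut_left_suffix by blast
qed (use assms cutD in auto)

text \<open>Needed to separate a unit in front of a product that starts with a generator from
  \<open>X\<close>.\<close>

lemma cut_append_prefix:
  assumes "height_zero_cut d1 d2" "rinv u"
  shows "no_iv_prefix (d1 @ u)"
  unfolding no_iv_prefix_def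
proof (intro allI impI)
  fix p t assume p: "d1 @ u = p @ t" "iv p"
  from p(1) show "p = []"
  proof (rule append_eq_appendE)
    fix q assume "d1 = p @ q"
    then show ?thesis
      using assms p(2) cut_left_prefix by blast
  next
    fix q assume q: "p = d1 @ q" "u = q @ t"
    then have "iv q"
      using assms p(2) iv_suffix_rinv rinv_appendD by blast
    then have "iv d1"
      using q p(2) iv_append_right by blast
    then show ?thesis
      using assms(1) cut_left_not_iv by blast
  qed
qed

lemma unit_append_reduced:
  assumes "red g" "iv g" "red u" "rinv u" "no_iv_prefix u"
  shows "red (g @ u)"
proof (rule reduced_appendI)
  fix a s p b
  assume *: "g = a @ s" "u = p @ b" "s \<noteq> []" "p \<noteq> []" "iv (s @ p)"
  then have "iv p"
    using assms(4) iv_suffix_rinv rinv_appendD by blast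
  then show False
    using * assms(5) no_iv_prefixD by blast
qed (use assms in auto)

lemma append_unit_reduced:
  assumes "red e" "iv e" "red w" "no_iv_suffix w"
  shows "red (w @ e)"
proof (rule reduced_appendI)
  fix a s p b
  assume *: "w = a @ s" "e = p @ b" "s \<noteq> []" "p \<noteq> []" "iv (s @ p)"
  then have "iv p"
    using assms(2) iv_suffix_rinv rinv_appendD iv_rinv by blast
  then have "iv s"
    using * iv_append_right by blast
  then show False
    using * assms(4) no_iv_suffixD by blast
qed (use assms in auto)

lemma unit_prefix_unique:
  assumes "iv g" "iv g'" "g @ u = g' @ u'"
    and "no_iv_prefix u" "no_iv_prefix u'"
  shows "g = g' \<and> u = u'"
  using assms(3)
proof (rule append_eq_appendE)
  fix t assume t: "g = g' @ t" "u' = t @ u"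
  then show ?thesis
    using assms(1,2) no_iv_prefixD[of t u] assms(5) iv_append_left[of g' t] by simp
next
  fix t assume t: "g' = g @ t" "u = t @ u'"
  then show ?thesis
    using assms(1,2) no_iv_prefixD[of t u'] assms(4) iv_append_left[of g t] by simp
qed

lemma unit_suffix_unique:
  assumes "iv e" "iv e'" "w @ e = w' @ e'"
    and "no_iv_suffix w" "no_iv_suffix w'"
  shows "w = w' \<and> e = e'"
  using assms(3)
proof (rule append_eq_appendE)
  fix t assume t: "w = w' @ t" "e' = t @ e"
  then show ?thesis
    using assms(1,2) assms(4) no_iv_suffixD[of w' t] iv_append_right[of t e] by simp
next
  fix t assume t: "w' = w @ t" "e = t @ e'"
  then show ?thesis
    using assms(1,2) assms(5) no_iv_suffixD[of w t] iv_append_right[of t e'] by simp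
qed

text \<open>Applied to the right-hand part \<open>d2\<close> of a cut, to isolate the unit
  \<open>b\<close> that may react with a word on its left.\<close>

lemma ex_max_unit_prefix: "\<exists>b c. w = b @ c \<and> iv b \<and> no_iv_prefix c"
proof (induction "length w" arbitrary: w rule: less_induct)
  case less
  show ?case
  proof (cases "\<exists>p t. w = p @ t \<and> iv p \<and> p \<noteq> []")
    case True
    then obtain p t where p: "w = p @ t" "iv p" "p \<noteq> []"
      by blast
    then obtain b c where "t = b @ c" "iv b" "no_iv_prefix c"
      using less[of t] by auto
    then show ?thesis
      using p iv_append[of p b] by (intro exI[of _ "p @ b"] exI[of _ c]) auto
  next
    case False
    then show ?thesis
      by (intro exI[of _ "[]"] exI[of _ w]) (auto simp: no_iv_prefix_def)
  qed
qed

context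
  fixes d1 b c w
  assumes cut: "height_zero_cut d1 (b @ c)" and b: "iv b"
    and c: "no_iv_prefix c"
    and w: "red w" "linv w"
begin

text \<open>Here \<open>w\<close> stands for the reduced form of \<open>v @ b\<close>. In a crossing
  word \<open>s @ p\<close> the part \<open>s\<close> is invertible because \<open>w\<close> is left
  invertible, so \<open>p\<close> would be an invertible prefix of \<open>c\<close>; none is left
  after absorbing \<open>b\<close>.\<close>

lemma append_cut_reduced: "red (w @ c)"
proof (rule reduced_appendI)
  show "red c"
    using cutD(4)[OF cut] reduced_appendD2 by blast
  fix x s p y
  assume *: "w = x @ s" "c = p @ y" "s \<noteq> []" "p \<noteq> []" "iv (s @ p)"
  then have "iv s"
    using w iv_prefix_linv linv_appendD by blast
  then have "iv p"
    using * iv_append_left by blast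
  then show False
    using * c no_iv_prefixD by blast
qed (rule w)

text \<open>This lets a trailing unit be separated. A suffix reaching into \<open>w\<close> would
  make \<open>c\<close> invertible, hence empty, and then \<open>d1\<close> would be invertible as
  well.\<close>

lemma append_cut_suffix: "no_iv_suffix (w @ c)"
proof (rule no_iv_suffixI)
  fix t s assume s: "w @ c = t @ s" "iv s"
  from s(1) show "s = []"
  proof (rule append_eq_appendE)
    fix q assume q: "w = t @ q" "s = q @ c"
    then have "iv q"
      using s w iv_prefix_linv linv_appendD by blast
    then have "iv c"
      using s q iv_append_left by blast
    then have "c = []"
      using no_iv_prefixD[of c "[]"] c by simp
    then have "iv d1"
      using cutD(5)[OF cut] b iv_append_right[of d1 b] by simp
    then show ?thesis
      using cut cut_left_not_iv by blast
  next
    fix q assume "c = q @ s"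
    then show ?thesis
      using cut_right_suffix[of d1 "b @ q" s] cut s(2) by simp
  qed
qed

end

text \<open>Let two height zero cuts be continued to the same word \<open>d1 u\<close>, \<open>d1' u'\<close> on the left and to
  the same \<open>w c\<close> on the right. If \<open>d1' = d1 p\<close> is longer than \<open>d1\<close>, then either \<open>d1' | b' c'\<close> is cut
  across by the invertible proper factor \<open>p | b' q\<close>, or \<open>p\<close> is an invertible suffix of \<open>d1'\<close>.\<close>

lemma cut_not_longer:
  assumes cut: "height_zero_cut d1 (b @ c)" "height_zero_cut (d1 @ p) (b' @ c')"
    and b: "iv b" "iv b'"
    and uv: "cls ((p @ u) @ v) = cls []" "cls (u @ v') = cls []"
    and w: "cls w = cls (v @ b)" "cls w' = cls (v' @ b')" "linv w'"
    and eq: "w @ c = w' @ c'"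
  shows "p = []"
  using eq
proof (rule append_eq_appendE)
  have p_suffix: "iv p \<Longrightarrow> p = []"
    using cut(2) by (rule cut_left_suffix)
  \<comment> \<open>Since \<open>w\<close> represents \<open>v b\<close>, the partner of
    \<open>v\<close> cancels it and only the unit \<open>b\<close> remains.\<close>
  have uw: "cls ((p @ u) @ w) = cls b" "cls (u @ w') = cls b'"
    using cls_append[OF HOL.refl w(1), of "p @ u"] cls_append[OF HOL.refl w(2), of u]
      cls_insert[OF uv(1), of "[]" b] cls_insert[OF uv(2), of "[]" b'] by simp_all
  {
    \<comment> \<open>Here \<open>p b' q\<close> equals the unit \<open>b\<close>. It starts after
      the nonempty word \<open>d1\<close>, so if it crossed the second cut it would contradict
      height 0.\<close>
    fix q assume q: "w = w' @ q" "c' = q @ c"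
    have "cls (p @ b' @ q) = cls (p @ (u @ w') @ q)"
      by (intro cls_context uw(2)[symmetric])
    also have "\<dots> = cls b"
      using q uw(1) by simp
    finally have *: "iv (p @ b' @ q)"
      using b(1) iv_cong by blast
    show ?thesis
    proof (cases "b' @ q = []")
      case True
      then show ?thesis
        using * p_suffix by simp
    next
      case False
      then show ?thesis
        using cut_crossing[of d1 p "b' @ q" c] cut * q(2) cutD(1)[OF cut(1)] by auto
    qed
  next
    \<comment> \<open>Here \<open>p b'\<close> equals \<open>b q\<close>. It is right invertible
      because \<open>p\<close> begins the right invertible word \<open>p u\<close>, and left
      invertible because \<open>q\<close> ends \<open>w'\<close>.\<close>
    fix q assume q: "w' = w @ q" "c = q @ c'"
    have "cls (p @ b') = cls (p @ u @ w')"
      by (intro cls_append HOL.refl uw(2)[symmetric])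
    also have "\<dots> = cls (b @ q)"
      using q cls_append[OF uw(1) HOL.refl, of q] by simp
    finally have pb: "cls (p @ b') = cls (b @ q)" .
    have "rinv p"
      using uv(1) unfolding rinv_def by auto
    then have "rinv (p @ b')"
      using b(2) by (simp add: rinv_append iv_rinv)
    moreover have "linv q"
      using w(3) q(1) linv_appendD by blast
    then have "linv (b @ q)"
      using b(1) by (simp add: linv_append iv_linv)
    then have "linv (p @ b')"
      using linv_cong[OF pb] by simp
    ultimately have "iv (p @ b')"
      by (intro ivI)
    then have "iv p"
      using b(2) iv_append_right by blast
    then show ?thesis
      by (rule p_suffix)
  }
qed

text \<open>The word form of cancelling a generator of \<open>X\<close> on the left. The first
  components give \<open>d1 u = d1' u'\<close> as words, the second ones \<open>w c = w' c'\<close>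
  and \<open>e = e'\<close>; \<open>cut_not_longer\<close>, used in both directions, then gives
  \<open>d1 = d1'\<close>. The conclusion speaks of \<open>d2 @ e\<close> because this is the second
  component of the generator.\<close>

lemma cut_unique:
  assumes cut: "height_zero_cut d1 d2" "height_zero_cut d1' d2'"
    and u: "red u" "red u'" and uv: "cls (u @ v) = cls []" "cls (u' @ v') = cls []"
    and e: "red e" "red e'" "iv e" "iv e'"
    and eq: "cls (d1 @ u) = cls (d1' @ u')" "cls (v @ d2 @ e) = cls (v' @ d2' @ e')"
  shows "d1 = d1' \<and> d2 @ e = d2' @ e' \<and> u = u' \<and> cls v = cls v'"
proof -
  obtain b c where bc: "d2 = b @ c" "iv b" "no_iv_prefix c"
    using ex_max_unit_prefix[of d2] by blast
  obtain b' c' where bc': "d2' = b' @ c'" "iv b'" "no_iv_prefix c'"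
    using ex_max_unit_prefix[of d2'] by blast
  have rl: "rinv u" "rinv u'" "linv v" "linv v'"
    using uv unfolding rinv_def linv_def by blast+
  then have lvb: "linv (v @ b)" "linv (v' @ b')"
    using bc(2) bc'(2) by (auto intro: linv_append iv_linv)
  obtain w where w: "red w" "cls w = cls (v @ b)"
    using ex_reduced linv_lists lvb(1) by blast
  obtain w' where w': "red w'" "cls w' = cls (v' @ b')"
    using ex_reduced linv_lists lvb(2) by blast
  have lw: "linv w" "linv w'"
    using lvb w(2) w'(2) linv_cong by blast+
  note cut1 = cut(1)[unfolded bc(1)] and cut2 = cut(2)[unfolded bc'(1)]
  have "red (d1 @ u)" "red (d1' @ u')"
    using cut u rl by (auto intro: cut_append_reduced)
  then have du: "d1 @ u = d1' @ u'"
    using eq(1) by (rule reduced_unique)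
  note wc = append_cut_reduced[OF cut1 bc(2,3) w(1) lw(1)]
    append_cut_suffix[OF cut1 bc(2,3) w(1) lw(1)]
  note wc' = append_cut_reduced[OF cut2 bc'(2,3) w'(1) lw(2)]
    append_cut_suffix[OF cut2 bc'(2,3) w'(1) lw(2)]
  have "red ((w @ c) @ e)"
    using e(1,3) wc by (rule append_unit_reduced)
  moreover have "red ((w' @ c') @ e')"
    using e(2,4) wc' by (rule append_unit_reduced)
  moreover have "cls ((w @ c) @ e) = cls ((w' @ c') @ e')"
    using eq(2) bc(1) bc'(1) cls_append[OF w(2) HOL.refl, of "c @ e"]
      cls_append[OF w'(2) HOL.refl, of "c' @ e'"] by simp
  ultimately have wce: "(w @ c) @ e = (w' @ c') @ e'"
    by (rule reduced_unique)
  have wc_e: "w @ c = w' @ c' \<and> e = e'"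
    using e(3,4) wce wc(2) wc'(2) by (rule unit_suffix_unique)
  have "d1 = d1' \<and> u = u'"
    using du
  proof (rule append_eq_appendE)
    fix p assume "d1 = d1' @ p" "u' = p @ u"
    then show ?thesis
      using cut_not_longer[of d1' b' c' p b c u v' v w' w] cut1 cut2 bc bc' uv w w' lw wc_e by simp
  next
    fix p assume "d1' = d1 @ p" "u = p @ u'"
    then show ?thesis
      using cut_not_longer[of d1 b c p b' c' u' v v' w w'] cut1 cut2 bc bc' uv w w' lw wc_e by simp
  qed
  then have d: "d1 = d1'" "u = u'"
    by auto
  \<comment> \<open>Now that \<open>u = u'\<close>, the same right invertible word sends
    \<open>w\<close> to \<open>b\<close> and \<open>w'\<close> to \<open>b'\<close>. A difference
    \<open>q\<close> between \<open>w\<close> and \<open>w'\<close> is thus a quotient of units, and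
    as a prefix of \<open>c\<close> or \<open>c'\<close> it must be empty.\<close>
  have uw: "cls (u @ w) = cls b" "cls (u @ w') = cls b'"
    using cls_append[OF HOL.refl w(2), of u] cls_append[OF HOL.refl w'(2), of u] d
      cls_insert[OF uv(1), of "[]" b] cls_insert[OF uv(2), of "[]" b'] by simp_all
  have "w = w' \<and> c = c'"
    using conjunct1[OF wc_e]
  proof (rule append_eq_appendE)
    fix q assume q: "w = w' @ q" "c' = q @ c"
    then have "cls (b' @ q) = cls b"
      using uw cls_append[OF uw(2) HOL.refl, of q] by simp
    then have "iv q"
      using bc(2) bc'(2) iv_cong iv_append_left by blast
    then show ?thesis
      using q bc'(3) no_iv_prefixD[of q c] by simp
  next
    fix q assume q: "w' = w @ q" "c = q @ c'"
    then have "cls (b @ q) = cls b'"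
      using uw cls_append[OF uw(1) HOL.refl, of q] by simp
    then have "iv q"
      using bc(2) bc'(2) iv_cong iv_append_left by blast
    then show ?thesis
      using q bc(3) no_iv_prefixD[of q c'] by simp
  qed
  then have wc_eq: "w = w'" "c = c'"
    by auto
  then have bb: "cls b = cls b'"
    using uw by simp
  have "red b" "red b'"
    using cutD(4)[OF cut1] cutD(4)[OF cut2] reduced_appendD1 by blast+
  then have "b = b'"
    using bb by (rule reduced_unique)
  \<comment> \<open>\<open>v\<close> is recovered from \<open>w\<close>, which represents
    \<open>v b\<close>, by cancelling the unit \<open>b\<close>.\<close>
  obtain s where "cls (b @ s) = cls []"
    using bc(2) unfolding iv_iff by blast
  then have "cls v = cls ((v @ b) @ s)" "cls v' = cls ((v' @ b) @ s)"
    using cls_insert[of "b @ s" v "[]"] cls_insert[of "b @ s" v' "[]"] by simp_all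
  moreover have "cls (v @ b) = cls (v' @ b)"
    using w w' wc_eq \<open>b = b'\<close> by simp
  ultimately have "cls v = cls v'"
    using cls_append[of "v @ b" "v' @ b" s s] by simp
  then show ?thesis
    using d wc_e wc_eq bc(1) bc'(1) \<open>b = b'\<close> by simp
qed

section \<open>The monoid of one-sided inverse pairs\<close>

abbreviation "N \<equiv> inverse_pairs M"
abbreviation "X \<equiv> X_gens A ws r"
abbreviation "Y \<equiv> Y_gens A ws r"

definition unit_pair :: "'a list set \<Rightarrow> 'a list set \<times> 'a list set" where
  "unit_pair g = (g, inv\<^bsub>M\<^esub> g)"

sublocale M: monoid M
  by (rule monoid_M)

sublocale N: monoid N
  by (rule monoid_inverse_pairs) (rule monoid_M)

section \<open>Representing pairs, units and generators by words\<close>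

lemma cls_pair_in_N: "cls (u @ v) = cls [] \<Longrightarrow> (cls u, cls v) \<in> carrier N"
  using cls_Nil_lists[of "u @ v"] by (simp add: mult_M one_M)

lemma N_cases:
  assumes "m \<in> carrier N"
  obtains u v where "red u" "red v" "m = (cls u, cls v)" "cls (u @ v) = cls []"
proof -
  obtain x y where m: "m = (x, y)" "x \<in> carrier M" "y \<in> carrier M" "x \<otimes>\<^bsub>M\<^esub> y = \<one>\<^bsub>M\<^esub>"
    using assms by (cases m) simp
  obtain u where u: "red u" "cls u = x"
    using m(2) ex_reduced unfolding carrier_M by blast
  obtain v where v: "red v" "cls v = y"
    using m(3) ex_reduced unfolding carrier_M by blast
  show thesis
    using that[of u v] m u v mult_M[of u v] reduced_lists by (simp add: one_M)
qed

lemma inv_cls: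
  assumes "cls (u @ v) = cls []" "cls (v @ u) = cls []"
  shows "inv\<^bsub>M\<^esub> (cls u) = cls v"
  using M.inv_unique'[of "cls u" "cls v"] assms cls_Nil_lists[of "u @ v"] by (simp add: mult_M one_M)

lemma Units_cases:
  assumes "g \<in> Units M"
  obtains u v where "red u" "iv u" "g = cls u" "unit_pair g = (cls u, cls v)"
    "cls (u @ v) = cls []" "cls (v @ u) = cls []"
proof -
  have "g \<in> carrier M"
    using assms by (rule M.Units_closed)
  then obtain u where u: "red u" "cls u = g"
    using ex_reduced unfolding carrier_M by blast
  then have "iv u"
    using assms reduced_lists by (simp add: invertible_word_def)
  then obtain v where "cls (u @ v) = cls []" "cls (v @ u) = cls []"
    unfolding iv_iff by blast
  then show thesis
    using that[of u v] u \<open>iv u\<close> inv_cls[of u v] by (simp add: unit_pair_def)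
qed

lemma inverse_word:
  assumes "iv u"
  shows "red (inverse_word A ws r u)" "cls (u @ inverse_word A ws r u) = cls []"
    "cls (inverse_word A ws r u @ u) = cls []" "iv (inverse_word A ws r u)"
    "cls (inverse_word A ws r u) = inv\<^bsub>M\<^esub> (cls u)"
proof -
  obtain v where v: "cls (u @ v) = cls []" "cls (v @ u) = cls []"
    using assms unfolding iv_iff by blast
  have "v \<in> lists A"
    using cls_Nil_lists[OF v(1)] by simp
  then obtain v' where "red v'" "cls v' = cls v"
    using ex_reduced by blast
  then have "\<exists>v'. red v' \<and> cls v' = inv\<^bsub>M\<^esub> (cls u)"
    using inv_cls[OF v] by auto
  from someI_ex[OF this] have *: "red (inverse_word A ws r u)"
    "cls (inverse_word A ws r u) = inv\<^bsub>M\<^esub> (cls u)"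
    unfolding inverse_word_def by auto
  then show "red (inverse_word A ws r u)" "cls (inverse_word A ws r u) = inv\<^bsub>M\<^esub> (cls u)"
    by auto
  from * have "cls (inverse_word A ws r u) = cls v"
    using inv_cls[OF v] by simp
  then show "cls (u @ inverse_word A ws r u) = cls []" "cls (inverse_word A ws r u @ u) = cls []"
    using v cls_append by metis+
  then show "iv (inverse_word A ws r u)"
    unfolding iv_iff by blast
qed

lemma unit_pair_in_N: "g \<in> Units M \<Longrightarrow> unit_pair g \<in> carrier N"
  by (auto simp: unit_pair_def M.Units_r_inv)

text \<open>The reversed multiplication of second components in \<open>N\<close> matches the inverse
  of a product.\<close>

lemma unit_pair_mult:
  assumes "g \<in> Units M" "h \<in> Units M"
  shows "unit_pair (g \<otimes>\<^bsub>M\<^esub> h) = unit_pair g \<otimes>\<^bsub>N\<^esub> unit_pair h"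
proof -
  interpret U: group "units_of M"
    by (rule M.units_group)
  have "inv\<^bsub>M\<^esub> (g \<otimes>\<^bsub>M\<^esub> h) = inv\<^bsub>M\<^esub> h \<otimes>\<^bsub>M\<^esub> inv\<^bsub>M\<^esub> g"
    using U.inv_mult_group[of g h] assms by (simp add: M.units_of_inv units_of_carrier units_of_mult)
  then show ?thesis
    by (simp add: unit_pair_def)
qed

lemma unit_pair_one: "unit_pair \<one>\<^bsub>M\<^esub> = \<one>\<^bsub>N\<^esub>"
  by (simp add: unit_pair_def)

lemma X_cases:
  assumes "x \<in> X"
  obtains d1 d2 e where "height_zero_cut d1 d2" "x = (cls d1, cls (d2 @ e))" "red e" "iv e"
    "cls ((d1 @ d2) @ e) = cls []"
proof -
  obtain d1 d2 where "height_zero_cut d1 d2" "x = (cls d1, cls (d2 @ inverse_word A ws r (d1 @ d2)))"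
    using assms unfolding X_gens_def height_zero_cut_def by blast
  then show thesis
    using that[of d1 d2] inverse_word[OF cutD(5)] by blast
qed

lemma X_in_N: "X \<subseteq> carrier N"
proof
  fix x assume "x \<in> X"
  then obtain d1 d2 e where "x = (cls d1, cls (d2 @ e))" "cls ((d1 @ d2) @ e) = cls []"
    by (rule X_cases)
  then show "x \<in> carrier N"
    using cls_pair_in_N[of d1 "d2 @ e"] by simp
qed

text \<open>This bounds \<open>X\<close>: every generator comes from cutting one of the finitely
  many words of \<Delta>. If \<open>d1 @ d2\<close> is not reduced, a left-hand side crosses the cut
  and by height 0 is the whole word, so \<open>d1 @ d2\<close> is in \<open>D\<close> either way;
  having no invertible proper prefix, it is a single factor.\<close>

lemma cut_in_Delta:
  assumes "height_zero_cut d1 d2"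
  shows "d1 @ d2 \<in> Delta A ws"
proof -
  note cut = cutD[OF assms]
  have prefix: "t = []" if "d1 @ d2 = q @ t" "iv q" "q \<noteq> []" for q t
    using that(1)
  proof (rule append_eq_appendE)
    fix s assume "d1 = q @ s"
    then show ?thesis
      using assms that cut_left_prefix by blast
  next
    fix s assume s: "q = d1 @ s" "d2 = s @ t"
    then have "s \<noteq> []"
      using assms that cut_left_not_iv by auto
    then show ?thesis
      using cut_crossing[of "[]" d1 s t] s cut assms that by simp
  qed
  have "d1 @ d2 \<in> D"
  proof (cases "red (d1 @ d2)")
    case True
    then show ?thesis
      using cut reduced_iv_D by blast
  next
    case False
    then obtain x s p y where *: "d1 = x @ s" "d2 = p @ y" "s \<noteq> []" "p \<noteq> []" "s @ p \<in> D"
      using not_reduced_appendD cut by metis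
    then show ?thesis
      using cut_crossing[of x s p y] assms D_iv by simp
  qed
  then have "d1 @ d2 = [] \<or> (\<exists>d w. d \<in> Delta A ws \<and> d1 @ d2 = d @ w)"
    by (induction rule: D_induct) auto
  then show ?thesis
    using cut(1) prefix Delta_indecomposable indecomposable_iv indecomposable_ne by fastforce
qed

lemma finite_X: "finite X"
proof -
  let ?B = "\<Union>d\<in>Delta A ws. (\<lambda>n. (take n d, drop n d)) ` {..length d}"
  let ?f = "\<lambda>(d1, d2). (cls d1, cls (d2 @ inverse_word A ws r (d1 @ d2)))"
  have "X \<subseteq> ?f ` ?B"
  proof
    fix x assume "x \<in> X"
    then obtain d1 d2 where *: "height_zero_cut d1 d2"
        "x = (cls d1, cls (d2 @ inverse_word A ws r (d1 @ d2)))"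
      unfolding X_gens_def height_zero_cut_def by blast
    have "(d1, d2) \<in> (\<lambda>n. (take n (d1 @ d2), drop n (d1 @ d2))) ` {..length (d1 @ d2)}"
      by (rule image_eqI[of _ _ "length d1"]) simp_all
    then have "(d1, d2) \<in> ?B"
      using cut_in_Delta[OF *(1)] by (intro UN_I)
    then show "x \<in> ?f ` ?B"
      using *(2) by (intro image_eqI[of _ _ "(d1, d2)"]) simp
  qed
  moreover have "finite (?f ` ?B)"
    using finite_Delta by simp
  ultimately show ?thesis
    by (rule finite_subset)
qed

lemma finite_Y: "finite Y"
proof -
  have "Y = (\<lambda>d. (cls d, cls (inverse_word A ws r d))) ` Delta A ws"
    unfolding Y_gens_def by blast
  then show ?thesis
    using finite_Delta by simp
qed

section \<open>Generating the copy of \<open>G\<close> and all of \<open>N\<close>\<close>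

lemma submonoid_units: "submonoid (unit_pair ` Units M) N"
proof
  show "unit_pair ` Units M \<subseteq> carrier N"
    using unit_pair_in_N by blast
  show "x \<otimes>\<^bsub>N\<^esub> y \<in> unit_pair ` Units M"
    if xy: "x \<in> unit_pair ` Units M" "y \<in> unit_pair ` Units M" for x y
  proof -
    obtain g h where "g \<in> Units M" "h \<in> Units M" "x = unit_pair g" "y = unit_pair h"
      using xy by blast
    then show ?thesis
      by (intro image_eqI[of _ _ "g \<otimes>\<^bsub>M\<^esub> h"]) (simp_all only: unit_pair_mult M.Units_m_closed)
  qed
  show "\<one>\<^bsub>N\<^esub> \<in> unit_pair ` Units M"
    unfolding unit_pair_one[symmetric] by (rule imageI) (rule M.Units_one_closed)
qed

lemma Y_eq: "Y = unit_pair ` cls ` Delta A ws"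
proof -
  have "(cls d, cls (inverse_word A ws r d)) = unit_pair (cls d)" if "d \<in> Delta A ws" for d
    using inverse_word(5) that Delta_indecomposable indecomposable_iv by (simp add: unit_pair_def)
  moreover have "Y = (\<lambda>d. (cls d, cls (inverse_word A ws r d))) ` Delta A ws"
    unfolding Y_gens_def by blast
  ultimately show ?thesis
    unfolding image_image by (metis (no_types, lifting) image_cong)
qed

lemma iv_Units: "iv u \<Longrightarrow> cls u \<in> Units M"
  by (simp add: invertible_word_def)

lemma Y_units: "Y \<subseteq> unit_pair ` Units M"
  unfolding Y_eq using iv_Units Delta_indecomposable indecomposable_iv by blast

text \<open>Every unit has a reduced representative, which is a word over \<Delta> by
  \<open>reduced_iv_D\<close>; hence the copy of \<open>G\<close> is generated by \<open>Y\<close>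
  as a monoid.\<close>

lemma generated_Y: "submonoid_generated N Y = unit_pair ` Units M"
proof
  show "submonoid_generated N Y \<subseteq> unit_pair ` Units M"
    using Y_units submonoid_units by (rule submonoid_generated_minimal)
  interpret S: submonoid "submonoid_generated N Y" N
    using N.monoid_axioms Y_units submonoid.subset[OF submonoid_units]
    by (intro submonoid_submonoid_generated) auto
  have D: "unit_pair (cls w) \<in> submonoid_generated N Y" if "w \<in> D" for w
    using that
  proof (induction rule: D_induct)
    case Nil
    show ?case
      unfolding one_M[symmetric] unit_pair_one by (rule S.one_closed)
  next
    case (append d w)
    have "iv d" "iv w"
      using append D_iv Delta_D by auto
    then have "unit_pair (cls (d @ w)) = unit_pair (cls d) \<otimes>\<^bsub>N\<^esub> unit_pair (cls w)"
      using unit_pair_mult[OF iv_Units iv_Units] by (simp add: mult_M iv_lists)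
    moreover have "unit_pair (cls d) \<in> submonoid_generated N Y"
      using append(1) by (intro submonoid_generated_inc) (simp add: Y_eq)
    ultimately show ?case
      using append by simp
  qed
  show "unit_pair ` Units M \<subseteq> submonoid_generated N Y"
  proof
    fix y assume "y \<in> unit_pair ` Units M"
    then obtain g where g: "g \<in> Units M" "y = unit_pair g"
      by blast
    from g(1) obtain u where "red u" "iv u" "g = cls u"
      by (rule Units_cases)
    then show "y \<in> submonoid_generated N Y"
      using g D reduced_iv_D by blast
  qed
qed

text \<open>A reduced \<open>u\<close> with right inverse \<open>v\<close> either ends in an invertible word, which splits off, or
  the reducible word \<open>u v\<close> contains an invertible word across the boundary; a shortest such word
  \<open>s p\<close> gives the factor \<open>(s, p (s p)\<^sup>-\<^sup>1)\<close>.\<close>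

lemma pair_generated:
  "red u \<Longrightarrow> cls (u @ v) = cls [] \<Longrightarrow>
    (cls u, cls v) \<in> submonoid_generated N (unit_pair ` Units M \<union> X)"
proof (induction "length u" arbitrary: u v rule: less_induct)
  case less
  let ?S = "submonoid_generated N (unit_pair ` Units M \<union> X)"
  interpret S: submonoid ?S N
    using X_in_N submonoid.subset[OF submonoid_units]
    by (intro submonoid_submonoid_generated) (auto intro: N.monoid_axioms)
  \<comment> \<open>This is (\<open>a\<close>, \<open>b\<close>) (\<open>s\<close>,
    \<open>q\<close>) = (\<open>a s\<close>, \<open>q b\<close>). In both uses below
    \<open>b\<close> represents \<open>s v\<close>, so the left factor is again a pair of
    \<open>N\<close>, with a shorter first word.\<close>
  have mult: "(cls u, cls v) \<in> ?S"
    if "(cls a, cls b) \<in> ?S" "(cls s, cls q) \<in> ?S" "u = a @ s" "cls v = cls (q @ b)" for a b s q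
  proof -
    have "u \<in> lists A" "v \<in> lists A"
      using cls_Nil_lists[OF less.prems(2)] by auto
    then have "a \<in> lists A" "s \<in> lists A" "q \<in> lists A" "b \<in> lists A"
      using that cls_lists[OF that(4)] by auto
    then show ?thesis
      using S.m_closed[OF that(1,2)] that(3,4) by (simp add: mult_M)
  qed
  consider "u = []" | a s where "u = a @ s" "s \<noteq> []" "iv s"
    | "u \<noteq> []" "\<And>a s. u = a @ s \<Longrightarrow> iv s \<Longrightarrow> s = []"
    by blast
  then show ?case
  proof cases
    case 1
    then have *: "(cls u, cls v) = \<one>\<^bsub>N\<^esub>"
      using less.prems by (simp add: one_M)
    show ?thesis
      unfolding * by (rule S.one_closed)
  next
    case 2
    obtain q where q: "cls (s @ q) = cls []" "cls (q @ s) = cls []"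
      using 2(3) unfolding iv_iff by blast
    have "unit_pair (cls s) = (cls s, cls q)"
      using inv_cls[OF q] by (simp add: unit_pair_def)
    then have "(cls s, cls q) \<in> ?S"
      using iv_Units[OF 2(3)] by (intro submonoid_generated_inc) (metis UnI1 imageI)
    moreover have "(cls a, cls (s @ v)) \<in> ?S"
      using less.hyps[of a "s @ v"] less.prems 2 reduced_appendD1 by simp
    moreover have "cls v = cls (q @ s @ v)"
      using cls_insert[OF q(2), of "[]" v] by simp
    ultimately show ?thesis
      using mult 2 by blast
  next
    case 3
    have "v \<in> lists A"
      using cls_Nil_lists[OF less.prems(2)] by simp
    then obtain v' where v': "red v'" "cls v' = cls v"
      using ex_reduced by blast
    have uv': "cls (u @ v') = cls []"
      using cls_append[OF HOL.refl v'(2), of u] less.prems by simp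
    have "\<not> red (u @ v')"
      using reduced_unique[of "u @ v'" "[]"] uv' 3(1) by auto
    define P where "P = (\<lambda>(s, p). s \<noteq> [] \<and> p \<noteq> [] \<and> suffix s u \<and> prefix p v' \<and> iv (s @ p))"
    obtain x s0 p0 y where "u = x @ s0" "v' = p0 @ y" "s0 \<noteq> []" "p0 \<noteq> []" "s0 @ p0 \<in> D"
      using not_reduced_appendD[OF less.prems(1) v'(1) \<open>\<not> red (u @ v')\<close>] by blast
    then have "P (s0, p0)"
      using D_iv by (auto simp: P_def suffix_def)
    from exists_least_iff[THEN iffD1, OF exI, of "\<lambda>n. \<exists>c. P c \<and> n = length (fst c) + length (snd c)"]
    obtain sp where sp: "P sp" "\<And>c. P c \<Longrightarrow> length (fst sp) + length (snd sp) \<le> length (fst c) + length (snd c)"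
      using \<open>P (s0, p0)\<close> by (metis not_less)
    obtain s p where sp_eq: "sp = (s, p)"
      by fastforce
    obtain a where a: "u = a @ s"
      using sp(1) by (auto simp: sp_eq P_def suffix_def)
    obtain b where b: "v' = p @ b"
      using sp(1) by (auto simp: sp_eq P_def prefix_def)
    have sp_facts: "s \<noteq> []" "p \<noteq> []" "iv (s @ p)"
      using sp(1) by (auto simp: sp_eq P_def)
    \<comment> \<open>Whatever cuts across (\<open>s\<close>, \<open>p\<close>) also cuts across
      (\<open>u\<close>, \<open>v'\<close>), so minimality of the total length leaves only the whole
      word.\<close>
    have "cutting_occurrences A ws s p = {(s, p)}"
    proof -
      have "(s', p') = (s, p)" if c: "(s', p') \<in> cutting_occurrences A ws s p" for s' p'
      proof -
        have "suffix s' s" "prefix p' p"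
          using c by (auto simp: cutting_occurrences_def)
        moreover have "P (s', p')"
          using c a b by (auto simp: P_def cutting_occurrences_def suffix_appendI prefix_prefix)
        then have "length s + length p \<le> length s' + length p'"
          using sp(2)[of "(s', p')"] by (simp add: sp_eq)
        ultimately show ?thesis
          by (auto simp: suffix_def prefix_def)
      qed
      moreover have "(s, p) \<in> cutting_occurrences A ws s p"
        using sp_facts by (simp add: cutting_occurrences_def)
      ultimately show ?thesis
        by auto
    qed
    then have "height A ws s p = 0"
      by (rule height_singleton)
    moreover have "no_invertible_suffix A ws s"
      using 3(2) a by (auto simp: no_invertible_suffix_def suffix_def)
    moreover have "red s" "red p"
      using less.prems(1) v'(1) a b reduced_appendD1 reduced_appendD2 by blast+
    ultimately have "(cls s, cls (p @ inverse_word A ws r (s @ p))) \<in> X"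
      using sp_facts unfolding X_gens_def by blast
    then have "(cls s, cls (p @ inverse_word A ws r (s @ p))) \<in> ?S"
      by (intro submonoid_generated_inc) simp
    moreover have "(cls a, cls (s @ v')) \<in> ?S"
      using less.hyps[of a "s @ v'"] less.prems a sp_facts uv' reduced_appendD1 by simp
    moreover have "cls v = cls ((p @ inverse_word A ws r (s @ p)) @ s @ v')"
      using cls_insert[OF inverse_word(3)[OF sp_facts(3)], of p b] v'(2) b by simp
    ultimately show ?thesis
      using mult a by blast
  qed
qed

lemma generated_units_X: "submonoid_generated N (unit_pair ` Units M \<union> X) = carrier N"
proof
  interpret S: submonoid "submonoid_generated N (unit_pair ` Units M \<union> X)" N
    using X_in_N submonoid.subset[OF submonoid_units]
    by (intro submonoid_submonoid_generated) (auto intro: N.monoid_axioms)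
  show "submonoid_generated N (unit_pair ` Units M \<union> X) \<subseteq> carrier N"
    by (rule S.subset)
  show "carrier N \<subseteq> submonoid_generated N (unit_pair ` Units M \<union> X)"
  proof
    fix m assume "m \<in> carrier N"
    then show "m \<in> submonoid_generated N (unit_pair ` Units M \<union> X)"
      by (rule N_cases) (simp add: pair_generated)
  qed
qed

lemma generated_X_Y: "submonoid_generated N (X \<union> Y) = carrier N"
proof
  have XY: "X \<union> Y \<subseteq> carrier N"
    using X_in_N Y_units submonoid.subset[OF submonoid_units] by blast
  interpret S: submonoid "submonoid_generated N (X \<union> Y)" N
    using N.monoid_axioms XY by (rule submonoid_submonoid_generated)
  show "submonoid_generated N (X \<union> Y) \<subseteq> carrier N"
    by (rule S.subset)
  have "submonoid_generated N Y \<subseteq> submonoid_generated N (X \<union> Y)"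
    by (rule submonoid_generated_minimal[OF _ S.is_submonoid]) (auto intro: submonoid_generated_inc)
  moreover have "X \<subseteq> submonoid_generated N (X \<union> Y)"
    by (auto intro: submonoid_generated_inc)
  ultimately have "submonoid_generated N (unit_pair ` Units M \<union> X) \<subseteq> submonoid_generated N (X \<union> Y)"
    by (intro submonoid_generated_minimal S.is_submonoid) (simp add: generated_Y)
  then show "carrier N \<subseteq> submonoid_generated N (X \<union> Y)"
    by (simp add: generated_units_X)
qed

section \<open>Uniqueness of factorisations in \<open>N\<close>\<close>

lemma X_mult_unique:
  assumes "x \<in> X" "x' \<in> X" "m \<in> carrier N" "m' \<in> carrier N" "x \<otimes>\<^bsub>N\<^esub> m = x' \<otimes>\<^bsub>N\<^esub> m'"
  shows "x = x' \<and> m = m'"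
proof -
  obtain d1 d2 e where x: "height_zero_cut d1 d2" "x = (cls d1, cls (d2 @ e))" "red e" "iv e"
    using assms(1) by (rule X_cases)
  obtain d1' d2' e' where x': "height_zero_cut d1' d2'" "x' = (cls d1', cls (d2' @ e'))" "red e'" "iv e'"
    using assms(2) by (rule X_cases)
  obtain u v where m: "red u" "red v" "m = (cls u, cls v)" "cls (u @ v) = cls []"
    using assms(3) by (rule N_cases)
  obtain u' v' where m': "red u'" "red v'" "m' = (cls u', cls v')" "cls (u' @ v') = cls []"
    using assms(4) by (rule N_cases)
  have "cls (d1 @ u) = cls (d1' @ u')" "cls (v @ d2 @ e) = cls (v' @ d2' @ e')"
    using assms(5) x x' m m' by (simp_all add: mult_M reduced_lists cutD iv_lists)
  from cut_unique[OF x(1) x'(1) m(1) m'(1) m(4) m'(4) x(3) x'(3) x(4) x'(4) this]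
  show ?thesis
    using x(2) x'(2) m(3) m'(3) by simp
qed

text \<open>To separate a unit standing in front of such a product it suffices to look at first
  components.\<close>

lemma X_mult_cases:
  assumes "x \<in> X" "m \<in> carrier N"
  obtains u where "fst (x \<otimes>\<^bsub>N\<^esub> m) = cls u" "red u" "rinv u" "u \<noteq> []"
    "no_iv_prefix u"
proof -
  obtain d1 d2 e where x: "height_zero_cut d1 d2" "x = (cls d1, cls (d2 @ e))"
    using assms(1) by (rule X_cases)
  obtain u v where m: "red u" "m = (cls u, cls v)" "cls (u @ v) = cls []"
    using assms(2) by (rule N_cases)
  then have "rinv u"
    unfolding rinv_def by blast
  show thesis
  proof
    show "fst (x \<otimes>\<^bsub>N\<^esub> m) = cls (d1 @ u)"
      using x m by (simp add: mult_M reduced_lists cutD)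
    show "red (d1 @ u)"
      using x(1) m(1) \<open>rinv u\<close> by (rule cut_append_reduced)
    show "rinv (d1 @ u)" "d1 @ u \<noteq> []"
      using cutD[OF x(1)] \<open>rinv u\<close> by (auto intro: rinv_append)
    show "no_iv_prefix (d1 @ u)"
      using x(1) \<open>rinv u\<close> by (rule cut_append_prefix)
  qed
qed

lemma fst_unit_pair_mult:
  "g \<in> Units M \<Longrightarrow> m \<in> carrier N \<Longrightarrow> fst (unit_pair g \<otimes>\<^bsub>N\<^esub> m) = g \<otimes>\<^bsub>M\<^esub> fst m"
  by (cases m) (simp add: unit_pair_def)

lemma unit_not_factor:
  assumes "g \<in> Units M" "g' \<in> Units M" "x \<in> X" "m \<in> carrier N"
  shows "unit_pair g \<noteq> unit_pair g' \<otimes>\<^bsub>N\<^esub> (x \<otimes>\<^bsub>N\<^esub> m)"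
proof
  assume eq: "unit_pair g = unit_pair g' \<otimes>\<^bsub>N\<^esub> (x \<otimes>\<^bsub>N\<^esub> m)"
  obtain u where u: "fst (x \<otimes>\<^bsub>N\<^esub> m) = cls u" "red u" "u \<noteq> []"
    "no_iv_prefix u"
    using assms(3,4) by (rule X_mult_cases)
  obtain h where h: "red h" "iv h" "g' = cls h"
    using assms(2) by (rule Units_cases)
  have "g = fst (unit_pair g)"
    by (simp add: unit_pair_def)
  also have "\<dots> = g' \<otimes>\<^bsub>M\<^esub> fst (x \<otimes>\<^bsub>N\<^esub> m)"
    unfolding eq using assms X_in_N by (intro fst_unit_pair_mult) auto
  also have "\<dots> = cls (h @ u)"
    using h u by (simp add: mult_M reduced_lists)
  finally have "cls (h @ u) \<in> Units M"
    using assms(1) by simp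
  then have "iv (h @ u)"
    using h(1) u(2) by (simp add: invertible_word_def reduced_lists)
  then have "iv u"
    using h(2) iv_append_left by blast
  then show False
    using u(3,4) no_iv_prefixD[of u "[]"] by simp
qed

text \<open>The first components are a reduced unit followed by a word without invertible prefix,
  which fixes \<open>g\<close>. After cancelling \<open>unit_pair g\<close> in \<open>N\<close>,
  \<open>X_mult_unique\<close> applies to the whole pairs.\<close>

lemma unit_X_unique:
  assumes g: "g \<in> Units M" "g' \<in> Units M" and x: "x \<in> X" "x' \<in> X"
    and m: "m \<in> carrier N" "m' \<in> carrier N"
    and eq: "unit_pair g \<otimes>\<^bsub>N\<^esub> (x \<otimes>\<^bsub>N\<^esub> m) = unit_pair g' \<otimes>\<^bsub>N\<^esub> (x' \<otimes>\<^bsub>N\<^esub> m')"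
  shows "g = g' \<and> x = x' \<and> m = m'"
proof -
  have xm: "x \<otimes>\<^bsub>N\<^esub> m \<in> carrier N" "x' \<otimes>\<^bsub>N\<^esub> m' \<in> carrier N"
    using x m X_in_N by auto
  obtain u where u: "fst (x \<otimes>\<^bsub>N\<^esub> m) = cls u" "red u" "rinv u"
    "no_iv_prefix u"
    using x(1) m(1) by (rule X_mult_cases)
  obtain u' where u': "fst (x' \<otimes>\<^bsub>N\<^esub> m') = cls u'" "red u'" "rinv u'"
    "no_iv_prefix u'"
    using x(2) m(2) by (rule X_mult_cases)
  obtain h where h: "red h" "iv h" "g = cls h"
    using g(1) by (rule Units_cases)
  obtain h' where h': "red h'" "iv h'" "g' = cls h'"
    using g(2) by (rule Units_cases)
  have "cls (h @ u) = g \<otimes>\<^bsub>M\<^esub> fst (x \<otimes>\<^bsub>N\<^esub> m)"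
    using h u by (simp add: mult_M reduced_lists)
  also have "\<dots> = g' \<otimes>\<^bsub>M\<^esub> fst (x' \<otimes>\<^bsub>N\<^esub> m')"
    using eq fst_unit_pair_mult[OF g(1) xm(1)] fst_unit_pair_mult[OF g(2) xm(2)] by simp
  also have "\<dots> = cls (h' @ u')"
    using h' u' by (simp add: mult_M reduced_lists)
  finally have cls: "cls (h @ u) = cls (h' @ u')" .
  have "red (h @ u)" "red (h' @ u')"
    using unit_append_reduced[OF h(1,2) u(2,3,4)] unit_append_reduced[OF h'(1,2) u'(2,3,4)] by auto
  then have "h @ u = h' @ u'"
    using cls by (rule reduced_unique)
  then have "h = h'"
    using unit_prefix_unique[OF h(2) h'(2) _ u(4) u'(4)] by blast
  then have gg: "g = g'"
    using h(3) h'(3) by simp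
  have cancel: "unit_pair (inv\<^bsub>M\<^esub> g) \<otimes>\<^bsub>N\<^esub> (unit_pair g \<otimes>\<^bsub>N\<^esub> n) = n" if "n \<in> carrier N" for n
  proof -
    have "unit_pair (inv\<^bsub>M\<^esub> g) \<otimes>\<^bsub>N\<^esub> unit_pair g = \<one>\<^bsub>N\<^esub>"
      using g(1) unit_pair_mult[of "inv\<^bsub>M\<^esub> g" g] unit_pair_one by (metis M.Units_inv_Units M.Units_l_inv)
    then show ?thesis
      using that g(1) N.m_assoc[of "unit_pair (inv\<^bsub>M\<^esub> g)" "unit_pair g" n]
      by (metis M.Units_inv_Units N.l_one unit_pair_in_N)
  qed
  have "x \<otimes>\<^bsub>N\<^esub> m = x' \<otimes>\<^bsub>N\<^esub> m'"
    using cancel[OF xm(1)] cancel[OF xm(2)] eq[folded gg] by metis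
  then show ?thesis
    using X_mult_unique[OF x m] gg by simp
qed

lemma free_product_factorisation: "free_product_factorisation N (units_of M) unit_pair X"
proof -
  interpret G: group "units_of M"
    by (rule M.units_group)
  show ?thesis
  proof (unfold_locales, unfold units_of_carrier)
    show "unit_pair \<in> hom (units_of M) N"
      by (auto simp: hom_def units_of_carrier units_of_mult unit_pair_mult unit_pair_in_N)
    show "unit_pair \<one>\<^bsub>units_of M\<^esub> = \<one>\<^bsub>N\<^esub>"
      by (simp only: units_of_one unit_pair_one)
    show "inj_on unit_pair (Units M)"
      by (simp add: inj_on_def unit_pair_def)
    show "X \<subseteq> carrier N"
      by (rule X_in_N)
    show "submonoid_generated N (unit_pair ` Units M \<union> X) = carrier N"
      by (rule generated_units_X)
  qed (use unit_X_unique unit_not_factor in blast)+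
qed

end

theorem theorem4p8:
  fixes A :: "'a set" and ws :: "'a list list" and r :: "('a \<times> 'a) set"
  assumes "finite A"
    and "strict_linear_order_on A r"
    and "set ws \<subseteq> lists A"
  defines "M \<equiv> special_monoid A ws"
  defines "G \<equiv> units_of M"
  defines "N \<equiv> inverse_pairs M"
  defines "X \<equiv> X_gens A ws r"
  defines "Y \<equiv> Y_gens A ws r"
  shows "(\<exists>C :: ('a list set \<times> 'a list set) set.
            finite C \<and> N \<cong> free_product G (free_monoid C))
    \<and> finite (X \<union> Y)
    \<and> X \<union> Y \<subseteq> carrier N
    \<and> submonoid_generated N (X \<union> Y) = carrier N
    \<and> basis_of_free_submonoid N X
    \<and> (\<exists>\<phi> \<in> iso (free_product G (free_monoid X)) N.
          (\<forall>g \<in> carrier G. \<phi> (free_product_inl G (free_monoid X) g) = (g, inv\<^bsub>M\<^esub> g))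
        \<and> (\<forall>x \<in> X. \<phi> (free_product_inr G (free_monoid X) [x]) = x)
        \<and> \<phi> ` free_product_inl G (free_monoid X) ` carrier G = submonoid_generated N Y)"
proof -
  interpret special_presentation A ws r
    using assms(1-3) by unfold_locales
  interpret F: free_product_factorisation N G unit_pair X
    unfolding N_def G_def X_def M_def by (rule free_product_factorisation)
  \<comment> \<open>The finite set \<open>C\<close> of the first claim is \<open>X\<close>
    itself.\<close>
  have "N \<cong> free_product G (free_monoid X)"
    by (rule is_isoI, rule monoid_iso_sym[OF _ F.free_product_map_iso])
      (simp add: free_product_def monoid_presented_monoid)
  moreover have "finite X" "finite Y" "X \<union> Y \<subseteq> carrier N" "submonoid_generated N (X \<union> Y) = carrier N"
    using finite_X finite_Y X_in_N Y_units submonoid.subset[OF submonoid_units] generated_X_Y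
    unfolding N_def G_def X_def Y_def M_def by auto
  moreover have "F.free_product_map ` free_product_inl G (free_monoid X) ` carrier G = submonoid_generated N Y"
    unfolding image_image using generated_Y F.free_product_map_inl
    unfolding N_def G_def Y_def M_def by (simp add: units_of_carrier)
  moreover have "\<forall>g \<in> carrier G. F.free_product_map (free_product_inl G (free_monoid X) g) = (g, inv\<^bsub>M\<^esub> g)"
    using F.free_product_map_inl unfolding M_def unit_pair_def by simp
  ultimately show ?thesis
    using F.basis F.free_product_map_iso F.free_product_map_inr by blast
qed

end
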